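(* Let $A$ and $B$ be $n\times n$ positive contractions such that $A\le B$, and let $\mu$ and $\nu$ be their corresponding determinantal probability measures on $2^{[n]}$. Then $\mu\unlhd\nu$ and thus $\mu\preccurlyeq\nu$.
   Context: Notation: $[n]=\{1,\dots,n\}$; for a probability measure $\mu$ on $2^{[n]}$ its generating polynomial is $g_\mu(z_1,\dots,z_n)=\sum_{S\subseteq[n]}\mu(S)\prod_{i\in S}z_i$. A positive contraction is a positive semi-definite Hermitian matrix with all eigenvalues in $[0,1]$. For Hermitian matrices, $A\le B$ means that $B-A$ is positive semi-definite. The determinantal measure corresponding to a positive contraction $A$ is the probability measure $\mu$ on $2^{[n]}$ such that $\mu(\{T\subseteq[n]:S\subseteq T\})=\det(A[S])$ for every $S\subseteq[n]$, where $A[S]$ is the principal submatrix of $A$ indexed by $S$ (and $\det A[\emptyset]=1$). Stochastic domination: $\mu\preccurlyeq\nu$ means $\mu(\mathcal{A})\le\nu(\mathcal{A})$ for every increasing event $\mathcal{A}\subseteq2^{[n]}$, i.e. every collection $\mathcal A$ of subsets of $[n]$ closed upwards under inclusion. A polynomial in $\mathbb{C}[z_1,\dots,z_m]$ is stable if it has no zeros with $\mathrm{Im}(z_j)>0$ for all $j$. A probability measure is strongly Rayleigh if its generating polynomial is stable. For $f,g\in\mathbb{R}[z_1,\dots,z_n]$ write $f\ll g$ (proper position) if the polynomial $g+z_{n+1}f\in\mathbb{R}[z_1,\dots,z_{n+1}]$ is stable (equivalently, $g+if$ is stable). The relation $\unlhd$ on the set $\mathcal{SR}_n$ of strongly Rayleigh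 probability measures on $2^{[n]}$: first set $\mu\unlhd'\nu$ if there is a finite sequence $\mu=\mu_0,\mu_1,\dots,\mu_\ell=\nu$ in $\mathcal{SR}_n$ with $g_{\mu_0}\ll g_{\mu_1}\ll\cdots\ll g_{\mu_\ell}$; then $\mu\unlhd\nu$ if there are sequences $\{\mu_j\},\{\nu_j\}\subset\mathcal{SR}_n$ with $\mu_j\to\mu$, $\nu_j\to\nu$ and $\mu_j\unlhd'\nu_j$ for all $j$. (Determinantal measures of positive contractions are strongly Rayleigh.) *)

theory Defs
  imports
    "HOL-Probability.Probability_Mass_Function"
    "Jordan_Normal_Form.Schur_Decomposition"
    "Jordan_Normal_Form.DL_Submatrix"
begin

text \<open>
  The ground set of size \<open>n\<close> is \<open>{..<n}\<close>, in accordance with the zero-based indices of the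
  matrices from \<open>Jordan_Normal_Form\<close>. A probability measure on its power set is a \<open>nat set pmf\<close>
  supported on \<open>Pow {..<n}\<close>. A polynomial in \<open>m\<close> variables is represented by its polynomial
  function on \<open>nat \<Rightarrow> complex\<close>, which looks only at the arguments \<open>z 0, \<dots>, z (m - 1)\<close>.
\<close>

subsection \<open>Positive contractions and determinantal measures\<close>

definition hermitian :: "complex mat \<Rightarrow> bool" where
  "hermitian A \<longleftrightarrow> mat_adjoint A = A"

text \<open>In the order on type \<open>complex\<close>, \<open>0 \<le> w\<close> means that \<open>w\<close> is real and nonnegative.\<close>

definition pos_semidef :: "nat \<Rightarrow> complex mat \<Rightarrow> bool" where
  "pos_semidef n A \<longleftrightarrow>
     A \<in> carrier_mat n n \<and> hermitian A \<and> (\<forall>v \<in> carrier_vec n. 0 \<le> (A *\<^sub>v v) \<bullet>c v)"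

definition positive_contraction :: "nat \<Rightarrow> complex mat \<Rightarrow> bool" where
  "positive_contraction n A \<longleftrightarrow>
     pos_semidef n A \<and> (\<forall>k. eigenvalue A k \<longrightarrow> k \<in> complex_of_real ` {0..1})"

definition loewner_le :: "nat \<Rightarrow> complex mat \<Rightarrow> complex mat \<Rightarrow> bool" where
  "loewner_le n A B \<longleftrightarrow> pos_semidef n (B - A)"

definition prob_on :: "nat \<Rightarrow> nat set pmf \<Rightarrow> bool" where
  "prob_on n \<mu> \<longleftrightarrow> set_pmf \<mu> \<subseteq> Pow {..<n}"

text \<open>These conditions determine \<open>\<mu>\<close> uniquely, by inclusion-exclusion.\<close>

definition determinantal :: "nat \<Rightarrow> complex mat \<Rightarrow> nat set pmf \<Rightarrow> bool" where
  "determinantal n A \<mu> \<longleftrightarrow> prob_on n \<mu> \<and>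
     (\<forall>S \<subseteq> {..<n}. complex_of_real (measure_pmf.prob \<mu> {T. T \<subseteq> {..<n} \<and> S \<subseteq> T})
                   = Determinant.det (submatrix A S S))"

subsection \<open>Stochastic domination\<close>

definition increasing_event :: "nat \<Rightarrow> nat set set \<Rightarrow> bool" where
  "increasing_event n E \<longleftrightarrow> E \<subseteq> Pow {..<n} \<and> (\<forall>S T. S \<in> E \<and> S \<subseteq> T \<and> T \<subseteq> {..<n} \<longrightarrow> T \<in> E)"

definition stoch_dominated :: "nat \<Rightarrow> nat set pmf \<Rightarrow> nat set pmf \<Rightarrow> bool" where
  "stoch_dominated n \<mu> \<nu> \<longleftrightarrow>
     (\<forall>E. increasing_event n E \<longrightarrow> measure_pmf.prob \<mu> E \<le> measure_pmf.prob \<nu> E)"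

subsection \<open>Stability and the strongly Rayleigh property\<close>

definition gen_poly :: "nat \<Rightarrow> nat set pmf \<Rightarrow> (nat \<Rightarrow> complex) \<Rightarrow> complex" where
  "gen_poly n \<mu> z = (\<Sum>S \<in> Pow {..<n}. complex_of_real (pmf \<mu> S) * (\<Prod>i\<in>S. z i))"

definition stable :: "nat \<Rightarrow> ((nat \<Rightarrow> complex) \<Rightarrow> complex) \<Rightarrow> bool" where
  "stable m f \<longleftrightarrow> (\<forall>z. (\<forall>i<m. Im (z i) > 0) \<longrightarrow> f z \<noteq> 0)"

text \<open>
  For real polynomials \<open>f\<close>, \<open>g\<close> in the variables \<open>z 0, \<dots>, z (n - 1)\<close>; the extra variable
  is \<open>z n\<close>.
\<close>

definition proper_position ::
    "nat \<Rightarrow> ((nat \<Rightarrow> complex) \<Rightarrow> complex) \<Rightarrow> ((nat \<Rightarrow> complex) \<Rightarrow> complex) \<Rightarrow> bool" where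
  "proper_position n f g \<longleftrightarrow> stable (Suc n) (\<lambda>z. g z + z n * f z)"

definition strongly_Rayleigh :: "nat \<Rightarrow> nat set pmf set" where
  "strongly_Rayleigh n = {\<mu>. prob_on n \<mu> \<and> stable n (gen_poly n \<mu>)}"

subsection \<open>The relation on strongly Rayleigh measures\<close>

definition sr_le_chain :: "nat \<Rightarrow> nat set pmf \<Rightarrow> nat set pmf \<Rightarrow> bool" where
  "sr_le_chain n \<mu> \<nu> \<longleftrightarrow>
     (\<exists>(l::nat) \<rho>. \<rho> 0 = \<mu> \<and> \<rho> l = \<nu> \<and> (\<forall>i\<le>l. \<rho> i \<in> strongly_Rayleigh n) \<and>
        (\<forall>i<l. proper_position n (gen_poly n (\<rho> i)) (gen_poly n (\<rho> (Suc i)))))"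

definition prob_tendsto :: "nat \<Rightarrow> (nat \<Rightarrow> nat set pmf) \<Rightarrow> nat set pmf \<Rightarrow> bool" where
  "prob_tendsto n M \<mu> \<longleftrightarrow> (\<forall>S \<subseteq> {..<n}. (\<lambda>j. pmf (M j) S) \<longlonglongrightarrow> pmf \<mu> S)"

definition sr_le :: "nat \<Rightarrow> nat set pmf \<Rightarrow> nat set pmf \<Rightarrow> bool" where
  "sr_le n \<mu> \<nu> \<longleftrightarrow>
     \<mu> \<in> strongly_Rayleigh n \<and> \<nu> \<in> strongly_Rayleigh n \<and>
     (\<exists>M N. (\<forall>j. M j \<in> strongly_Rayleigh n \<and> N j \<in> strongly_Rayleigh n) \<and>
        prob_tendsto n M \<mu> \<and> prob_tendsto n N \<nu> \<and> (\<forall>j. sr_le_chain n (M j) (N j)))"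

end

theory Submission
  imports Defs
begin

text \<open>
  The measure with kernel \<open>K\<close> gives \<open>T\<close> the weight \<open>det (K P + (I - K) Q)\<close>, where \<open>P\<close>, \<open>Q\<close> are the
  coordinate projections onto \<open>T\<close> and its complement, so its generating polynomial is
  \<open>det (I + K (Z - I))\<close>. This is stable for every Hermitian \<open>K\<close>, because a null vector \<open>v\<close> and
  \<open>y = (Z - I) v\<close> would satisfy \<open>\<langle>v, y\<rangle> + \<langle>K y, y\<rangle> = 0\<close>, whose imaginary part forces \<open>v = 0\<close>. By the
  rank-one determinant formula, the same computation puts the polynomials of \<open>K\<close> and \<open>K + u u\<^sup>*\<close> in
  proper position. Since \<open>B - A\<close> is a sum of rank-one terms \<open>u u\<^sup>*\<close> and the intermediate kernels are
  contractions, \<open>\<mu>\<close> and \<open>\<nu>\<close> are joined by a finite chain, and no approximation is needed.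

  Stochastic domination goes by induction on the number of random coordinates, in the manner of Feder
  and Mihail. Conditioning on a coordinate \<open>k\<close> preserves the order of kernels, so \<open>\<mu> f \<le> \<nu> f\<close>
  follows for increasing \<open>f\<close> once some \<open>k\<close> is nonnegatively correlated with \<open>f\<close> under \<open>\<mu>\<close>. If there
  were none, consider the weights \<open>\<lambda> ^ card T\<close>: they increase the kernel, and comparing derivatives at
  \<open>\<lambda> = 1\<close> yields \<open>Cov (card T, f) \<ge> c Cov (card T, [k \<in> T])\<close> with
  \<open>c = Cov ([k \<in> T], f) / Var [k \<in> T] < 0\<close>. As distinct coordinates are negatively correlated, the right
  side is at least \<open>Cov ([k \<in> T], f)\<close>, whereas the left side is a sum of negative terms of which this
  is only one, unless \<open>k\<close> is independent of the other coordinates; then \<open>c \<ge> 0\<close> by induction.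
\<close>

subsection \<open>Hermitian kernels and Schur complements\<close>

text \<open>Kernels are functions on all pairs of naturals, but only entries below \<open>n\<close>
  carry meaning. Conditioning and reweighting thus stay entrywise formulas on one fixed index
  range.\<close>

definition mv :: "nat \<Rightarrow> (nat \<Rightarrow> nat \<Rightarrow> complex) \<Rightarrow> (nat \<Rightarrow> complex) \<Rightarrow> nat \<Rightarrow> complex" where
  "mv n K x i = (\<Sum>j<n. K i j * x j)"

definition ip :: "nat \<Rightarrow> (nat \<Rightarrow> complex) \<Rightarrow> (nat \<Rightarrow> complex) \<Rightarrow> complex" where
  "ip n x y = (\<Sum>i<n. x i * cnj (y i))"

definition psd :: "nat \<Rightarrow> (nat \<Rightarrow> nat \<Rightarrow> complex) \<Rightarrow> bool" where
  "psd n K \<longleftrightarrow> (\<forall>i<n. \<forall>j<n. K j i = cnj (K i j)) \<and> (\<forall>x. 0 \<le> Re (ip n (mv n K x) x))"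

definition idk :: "nat \<Rightarrow> nat \<Rightarrow> complex" where
  "idk i j = (if i = j then 1 else 0)"

definition contraction :: "nat \<Rightarrow> (nat \<Rightarrow> nat \<Rightarrow> complex) \<Rightarrow> bool" where
  "contraction n K \<longleftrightarrow> psd n K \<and> psd n (\<lambda>i j. idk i j - K i j)"

definition kle :: "nat \<Rightarrow> (nat \<Rightarrow> nat \<Rightarrow> complex) \<Rightarrow> (nat \<Rightarrow> nat \<Rightarrow> complex) \<Rightarrow> bool" where
  "kle n K L \<longleftrightarrow> psd n (\<lambda>i j. L i j - K i j)"

lemma idk_same: "idk k k = 1" by (simp add: idk_def)

section \<open>Calculus of the Hermitian form and of kernels as operators\<close>

lemma ip_add_left: "ip n (\<lambda>i. x i + x' i) y = ip n x y + ip n x' y"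
  by (simp add: ip_def algebra_simps sum.distrib)

lemma ip_diff_left: "ip n (\<lambda>i. x i - x' i) y = ip n x y - ip n x' y"
  by (simp add: ip_def algebra_simps sum_subtractf)

lemma ip_scale_left: "ip n (\<lambda>i. c * x i) y = c * ip n x y"
  by (simp add: ip_def algebra_simps sum_distrib_left)

lemma ip_add_right: "ip n x (\<lambda>i. y i + y' i) = ip n x y + ip n x y'"
  by (simp add: ip_def algebra_simps sum.distrib)

lemma ip_diff_right: "ip n x (\<lambda>i. y i - y' i) = ip n x y - ip n x y'"
  by (simp add: ip_def algebra_simps sum_subtractf)

lemma ip_scale_right: "ip n x (\<lambda>i. c * y i) = cnj c * ip n x y"
  by (simp add: ip_def algebra_simps sum_distrib_left)

lemma ip_commute: "ip n y x = cnj (ip n x y)"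
  by (simp add: ip_def mult.commute)

lemma ip_cong: "(\<And>i. i < n \<Longrightarrow> x i = x' i) \<Longrightarrow> (\<And>i. i < n \<Longrightarrow> y i = y' i) \<Longrightarrow> ip n x y = ip n x' y'"
  by (simp add: ip_def)

lemma ip_idk_right: "k < n \<Longrightarrow> ip n x (idk k) = x k"
  by (simp add: ip_def idk_def if_distrib[where f=cnj] if_distrib[where f="\<lambda>t. _ * t"] sum.delta' cong: if_cong)

lemma ip_idk_left: "k < n \<Longrightarrow> ip n (idk k) x = cnj (x k)"
  using ip_commute[of n "idk k" x] by (simp add: ip_idk_right)

lemma ip_self: "ip n x x = of_real (\<Sum>i<n. (cmod (x i))\<^sup>2)"
  by (simp add: ip_def complex_norm_square[symmetric])

lemma Re_ip_self_nonneg: "0 \<le> Re (ip n x x)"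
  by (simp add: ip_self sum_nonneg)

lemmas ip_linear = ip_add_left ip_diff_left ip_scale_left ip_add_right ip_diff_right ip_scale_right

lemma mv_add: "mv n K (\<lambda>i. x i + y i) = (\<lambda>i. mv n K x i + mv n K y i)"
  by (rule ext) (simp add: mv_def algebra_simps sum.distrib)

lemma mv_diff: "mv n K (\<lambda>i. x i - y i) = (\<lambda>i. mv n K x i - mv n K y i)"
  by (rule ext) (simp add: mv_def algebra_simps sum_subtractf)

lemma mv_scale: "mv n K (\<lambda>i. c * x i) = (\<lambda>i. c * mv n K x i)"
  by (rule ext) (simp add: mv_def algebra_simps sum_distrib_left)

lemma mv_kernel_add: "mv n (\<lambda>i j. K i j + L i j) x = (\<lambda>i. mv n K x i + mv n L x i)"
  by (rule ext) (simp add: mv_def algebra_simps sum.distrib)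

lemma mv_kernel_diff: "mv n (\<lambda>i j. K i j - L i j) x = (\<lambda>i. mv n K x i - mv n L x i)"
  by (rule ext) (simp add: mv_def algebra_simps sum_subtractf)

lemma mv_kernel_scale: "mv n (\<lambda>i j. c * K i j) x = (\<lambda>i. c * mv n K x i)"
  by (rule ext) (simp add: mv_def algebra_simps sum_distrib_left)

lemma mv_rank_one: "mv n (\<lambda>i j. u i * cnj (v j)) x = (\<lambda>i. ip n x v * u i)"
  by (rule ext) (simp add: mv_def ip_def algebra_simps sum_distrib_left)

lemma mv_idk_left: "i < n \<Longrightarrow> mv n idk x i = x i"
  by (simp add: mv_def idk_def if_distrib[where f="\<lambda>t. t * _"] cong: if_cong)

lemma mv_idk_right: "k < n \<Longrightarrow> mv n K (idk k) i = K i k"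
  by (simp add: mv_def idk_def if_distrib[where f="\<lambda>t. _ * t"] cong: if_cong)

lemma ip_mv_idk: "ip n (mv n idk x) y = ip n x y"
  by (rule ip_cong) (simp_all add: mv_idk_left)

lemma mv_compose: "mv n K (mv n L x) = mv n (\<lambda>i j. \<Sum>l<n. K i l * L l j) x"
proof
  fix i
  have "mv n K (mv n L x) i = (\<Sum>l<n. \<Sum>j<n. K i l * L l j * x j)"
    by (simp add: mv_def sum_distrib_left mult.assoc)
  also have "\<dots> = (\<Sum>j<n. \<Sum>l<n. K i l * L l j * x j)" by (rule sum.swap)
  finally show "mv n K (mv n L x) i = mv n (\<lambda>i j. \<Sum>l<n. K i l * L l j) x i"
    by (simp add: mv_def sum_distrib_right)
qed

lemma mv_cong: "(\<And>j. j < n \<Longrightarrow> K i j = L i j) \<Longrightarrow> (\<And>j. j < n \<Longrightarrow> x j = y j) \<Longrightarrow> mv n K x i = mv n L y i"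
  by (simp add: mv_def)

lemmas mv_kernel_linear = mv_kernel_add mv_kernel_diff mv_kernel_scale

section \<open>Positive semidefinite kernels\<close>

lemma psd_hermitian: "psd n K \<Longrightarrow> i < n \<Longrightarrow> j < n \<Longrightarrow> K j i = cnj (K i j)"
  unfolding psd_def by blast

lemma psd_nonneg: "psd n K \<Longrightarrow> 0 \<le> Re (ip n (mv n K x) x)"
  by (simp add: psd_def)

lemma ip_mv_adjoint:
  assumes "\<And>i j. i < n \<Longrightarrow> j < n \<Longrightarrow> K j i = cnj (K i j)"
  shows "ip n (mv n K x) y = ip n x (mv n K y)"
proof -
  have "ip n (mv n K x) y = (\<Sum>i<n. \<Sum>j<n. K i j * x j * cnj (y i))"
    by (simp add: ip_def mv_def sum_distrib_right)
  also have "\<dots> = (\<Sum>j<n. \<Sum>i<n. K i j * x j * cnj (y i))" by (rule sum.swap)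
  also have "\<dots> = (\<Sum>j<n. \<Sum>i<n. x j * cnj (K j i * y i))"
  proof (intro sum.cong refl)
    fix i j assume "j \<in> {..<n}" "i \<in> {..<n}"
    then have "K i j = cnj (K j i)" using assms[of j i] by simp
    then show "K i j * x j * cnj (y i) = x j * cnj (K j i * y i)" by (simp add: mult_ac)
  qed
  also have "\<dots> = ip n x (mv n K y)" by (simp add: ip_def mv_def sum_distrib_left)
  finally show ?thesis .
qed

lemma psd_adjoint: "psd n K \<Longrightarrow> ip n (mv n K x) y = ip n x (mv n K y)"
  by (rule ip_mv_adjoint) (rule psd_hermitian)

lemma psd_form_real: "psd n K \<Longrightarrow> Im (ip n (mv n K x) x) = 0"
  using psd_adjoint[of n K x x] ip_commute[of n x "mv n K x"] by (simp add: complex_eq_iff)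

lemma psd_form_nonneg: "psd n K \<Longrightarrow> 0 \<le> ip n (mv n K x) x"
  by (simp add: less_eq_complex_def psd_form_real psd_nonneg)

text \<open>Polarisation: reality of the form at e_i + e_j and at e_i + i e_j fixes the imaginary
  and the real part of \<open>K j i\<close> in terms of \<open>K i j\<close>.\<close>

lemma psdI_form:
  assumes "\<And>x. 0 \<le> ip n (mv n K x) x"
  shows "psd n K"
  unfolding psd_def
proof (intro conjI allI impI)
  have im: "Im (ip n (mv n K x) x) = 0" for x using assms[of x] by (simp add: less_eq_complex_def)
  fix i j assume ij: "i < n" "j < n"
  have e: "ip n (mv n K (\<lambda>t. idk i t + c * idk j t)) (\<lambda>t. idk i t + c * idk j t)
     = K i i + c * K i j + cnj c * K j i + c * cnj c * K j j" for c
    using ij by (simp add: mv_add mv_scale ip_linear ip_idk_right mv_idk_right algebra_simps)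
  have d: "Im (K i i) = 0" "Im (K j j) = 0" using im[of "idk i"] im[of "idk j"] ij
    by (simp_all add: ip_idk_right mv_idk_right)
  have "Im (K i j + K j i) = 0" using im[of "\<lambda>t. idk i t + 1 * idk j t"] d unfolding e by simp
  moreover have "Re (K i j) - Re (K j i) = 0"
    using im[of "\<lambda>t. idk i t + \<i> * idk j t"] d unfolding e by simp
  ultimately show "K j i = cnj (K i j)" by (simp add: complex_eq_iff)
next
  fix x show "0 \<le> Re (ip n (mv n K x) x)" using assms[of x] by (simp add: less_eq_complex_def)
qed

lemma psd_cong:
  assumes "\<And>i j. i < n \<Longrightarrow> j < n \<Longrightarrow> K i j = L i j"
  shows "psd n K \<longleftrightarrow> psd n L"
proof -
  have "ip n (mv n K x) x = ip n (mv n L x) x" for x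
    by (rule ip_cong) (use assms in \<open>auto intro: mv_cong\<close>)
  moreover have "(\<forall>i<n. \<forall>j<n. K j i = cnj (K i j)) \<longleftrightarrow> (\<forall>i<n. \<forall>j<n. L j i = cnj (L i j))"
    using assms by (metis (no_types))
  ultimately show ?thesis unfolding psd_def by (simp only:)
qed

lemma psd_add:
  assumes "psd n K" "psd n L" shows "psd n (\<lambda>i j. K i j + L i j)"
  by (rule psdI_form) (simp add: mv_kernel_linear ip_linear psd_form_nonneg assms)

lemma psd_rank_one: "psd n (\<lambda>i j. u i * cnj (u j))"
proof (rule psdI_form)
  fix x
  have "ip n (mv n (\<lambda>i j. u i * cnj (u j)) x) x = ip n x u * cnj (ip n x u)"
    by (simp add: mv_rank_one ip_linear ip_commute[of n u x])
  then show "0 \<le> ip n (mv n (\<lambda>i j. u i * cnj (u j)) x) x"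
    by (simp add: less_eq_complex_def complex_norm_square[symmetric] complex_mult_cnj)
qed

lemma psd_diag: assumes "psd n K" "k < n" shows "K k k = of_real (Re (K k k))" "0 \<le> Re (K k k)"
  using psd_nonneg[OF assms(1), of "idk k"] psd_hermitian[OF assms(1) assms(2) assms(2)] assms(2)
  by (simp_all add: mv_idk_right ip_idk_right complex_eq_iff)

lemma psd_column:
  assumes "psd n K" "k < n"
  shows "ip n (\<lambda>i. K i k) x = cnj (mv n K x k)"
proof -
  have "(\<lambda>i. K i k) = mv n K (idk k)" using assms(2) by (simp add: mv_idk_right fun_eq_iff)
  then show ?thesis using assms by (simp add: psd_adjoint ip_idk_left)
qed

lemma psd_form_shift:
  assumes "psd n K" "k < n"
  shows "Re (ip n (mv n K (\<lambda>i. x i - t * idk k i)) (\<lambda>i. x i - t * idk k i))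
    = Re (ip n (mv n K x) x) - 2 * Re (cnj t * mv n K x k) + (cmod t)\<^sup>2 * Re (K k k)"
proof -
  note 1 = psd_column[OF assms]
  have 2: "K k k = of_real (Re (K k k))" by (rule psd_diag[OF assms])
  have "ip n (mv n K (\<lambda>i. x i - t * idk k i)) (\<lambda>i. x i - t * idk k i)
    = ip n (mv n K x) x - cnj t * mv n K x k - cnj (cnj t * mv n K x k) + t * cnj t * of_real (Re (K k k))"
    using assms 2 by (simp add: mv_diff mv_scale ip_linear ip_idk_right mv_idk_right 1 algebra_simps
      psd_hermitian[OF assms(1,2,2), symmetric])
  also have "t * cnj t = of_real ((cmod t)\<^sup>2)" by (rule complex_norm_square[symmetric])
  finally show ?thesis by simp
qed

text \<open>With \<open>K k k = 0\<close> the form is affine along the \<open>k\<close>-th axis, so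
  nonnegativity forces its slope to vanish.\<close>

lemma psd_zero_diag:
  assumes "psd n K" "k < n" "K k k = 0"
  shows "mv n K x k = 0"
proof (rule ccontr)
  define s where "s = mv n K x k"
  assume "mv n K x k \<noteq> 0"
  then have s: "(cmod s)\<^sup>2 > 0" by (simp add: s_def)
  define q where "q = Re (ip n (mv n K x) x)"
  \<comment> \<open>\<open>M\<close> is chosen so that the shift by \<open>of_real M * s\<close>
    would give the form the value -1.\<close>
  define M where "M = (q + 1) / (2 * (cmod s)\<^sup>2)"
  have "0 \<le> q - 2 * Re (cnj (of_real M * s) * s)"
    using psd_nonneg[OF assms(1)] psd_form_shift[OF assms(1,2), of x "of_real M * s"] assms(3)
    by (metis (no_types, lifting) add.right_neutral mult_zero_right q_def s_def zero_complex.simps(1))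
  also have "cnj (of_real M * s) * s = of_real (M * (cmod s)\<^sup>2)"
    using complex_norm_square[of s] by (simp add: mult_ac)
  also have "M * (cmod s)\<^sup>2 = (q + 1) / 2" using s by (simp add: M_def)
  finally show False by simp
qed

lemma psd_zero_diag_entries:
  assumes "psd n K" "k < n" "K k k = 0" "j < n"
  shows "K k j = 0" "K j k = 0"
  using psd_zero_diag[OF assms(1-3), of "idk j"] psd_hermitian[OF assms(1) assms(2) assms(4)] assms(4)
  by (simp_all add: mv_idk_right)

text \<open>The Schur complement of the \<open>k\<close>-th pivot, kept at size \<open>n\<close>.
  For a positive semidefinite kernel its \<open>k\<close>-th row and column vanish, also when
  \<open>K k k = 0\<close>.\<close>

definition schur :: "(nat \<Rightarrow> nat \<Rightarrow> complex) \<Rightarrow> nat \<Rightarrow> nat \<Rightarrow> nat \<Rightarrow> complex" where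
  "schur K k i j = K i j - K i k * K k j / K k k"

lemma schur_form:
  assumes "psd n K" "k < n"
  shows "ip n (mv n (schur K k) x) x =
    of_real (Re (ip n (mv n K x) x) - (cmod (mv n K x k))\<^sup>2 / Re (K k k))"
proof -
  define s where "s = mv n K x k"
  have "mv n (schur K k) x = (\<lambda>i. mv n K x i - s / K k k * K i k)"
    by (intro ext) (simp add: schur_def s_def mv_def sum_subtractf algebra_simps
      sum_distrib_left sum_divide_distrib)
  then have "ip n (mv n (schur K k) x) x = ip n (mv n K x) x - s / K k k * cnj s"
    using assms by (simp only: ip_diff_left ip_scale_left psd_column s_def)
  also have "s / K k k * cnj s = of_real ((cmod s)\<^sup>2 / Re (K k k))"
    using psd_diag(1)[OF assms] by (metis complex_norm_square of_real_divide times_divide_eq_left)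
  also have "ip n (mv n K x) x = of_real (Re (ip n (mv n K x) x))"
    by (simp add: complex_eq_iff psd_form_real[OF assms(1)])
  finally show ?thesis by (simp add: s_def)
qed

text \<open>The Schur complement is the minimum of the quadratic form over the fibres of the projection
  along the \<open>k\<close>-th axis. Division by zero is harmless here, because a positive semidefinite
  kernel with \<open>K k k = 0\<close> has a vanishing \<open>k\<close>-th row and column.\<close>

lemma schur_form_le:
  assumes "psd n K" "k < n"
  shows "Re (ip n (mv n (schur K k) x) x) \<le>
    Re (ip n (mv n K (\<lambda>i. x i - t * idk k i)) (\<lambda>i. x i - t * idk k i))"
proof -
  define s where "s = mv n K x k"
  define c where "c = Re (K k k)"
  have c: "0 \<le> c" "K k k = of_real c" using psd_diag[OF assms] by (simp_all add: c_def)
  have "2 * Re (cnj t * s) - (cmod t)\<^sup>2 * c \<le> (cmod s)\<^sup>2 / c"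
  proof (cases "c = 0")
    case True
    then have "s = 0" using psd_zero_diag[OF assms] c by (simp add: s_def)
    then show ?thesis using True by simp
  next
    case False
    then have "c > 0" using c by simp
    have "0 \<le> (cmod (of_real c * t - s))\<^sup>2" by simp
    also have "\<dots> = c\<^sup>2 * (cmod t)\<^sup>2 - 2 * c * Re (cnj t * s) + (cmod s)\<^sup>2"
      unfolding cmod_power2 by (simp add: power2_eq_square algebra_simps)
    finally have "c * (2 * Re (cnj t * s) - (cmod t)\<^sup>2 * c) \<le> (cmod s)\<^sup>2"
      by (simp add: algebra_simps power2_eq_square)
    then show ?thesis using \<open>c > 0\<close> by (simp add: field_simps)
  qed
  then show ?thesis
    unfolding schur_form[OF assms] psd_form_shift[OF assms] by (simp add: s_def c_def)
qed

lemma schur_form_attained: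
  assumes "psd n K" "k < n"
  shows "\<exists>t. Re (ip n (mv n (schur K k) x) x) =
    Re (ip n (mv n K (\<lambda>i. x i - t * idk k i)) (\<lambda>i. x i - t * idk k i))"
proof
  define s where "s = mv n K x k"
  define c where "c = Re (K k k)"
  have c: "0 \<le> c" "K k k = of_real c" using psd_diag[OF assms] by (simp_all add: c_def)
  \<comment> \<open>The minimiser is \<open>s / c\<close>. For \<open>c = 0\<close> division by zero
    makes it 0, and both sides vanish.\<close>
  have "2 * Re (cnj (s / of_real c) * s) - (cmod (s / of_real c))\<^sup>2 * c = (cmod s)\<^sup>2 / c"
    unfolding cmod_power2 by (cases "c = 0") (simp_all add: power2_eq_square field_simps)
  then show "Re (ip n (mv n (schur K k) x) x) =
    Re (ip n (mv n K (\<lambda>i. x i - (mv n K x k / of_real (Re (K k k))) * idk k i))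
      (\<lambda>i. x i - (mv n K x k / of_real (Re (K k k))) * idk k i))"
    unfolding schur_form[OF assms] psd_form_shift[OF assms] by (simp add: s_def c_def)
qed

lemma schur_psd:
  assumes "psd n K" "k < n"
  shows "psd n (schur K k)"
proof (rule psdI_form)
  fix x
  obtain t where "Re (ip n (mv n (schur K k) x) x) =
    Re (ip n (mv n K (\<lambda>i. x i - t * idk k i)) (\<lambda>i. x i - t * idk k i))"
    using schur_form_attained[OF assms] by blast
  then have "0 \<le> Re (ip n (mv n (schur K k) x) x)" using psd_nonneg[OF assms(1)] by simp
  moreover have "Im (ip n (mv n (schur K k) x) x) = 0" by (simp add: schur_form[OF assms])
  ultimately show "0 \<le> ip n (mv n (schur K k) x) x" by (simp add: less_eq_complex_def)
qed

lemma kle_form: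
  assumes "kle n K L" shows "Re (ip n (mv n K x) x) \<le> Re (ip n (mv n L x) x)"
  using psd_nonneg[OF assms[unfolded kle_def], of x] by (simp add: mv_kernel_linear ip_linear)

lemma kle_formI:
  assumes "psd n K" "psd n L" "\<And>x. Re (ip n (mv n K x) x) \<le> Re (ip n (mv n L x) x)"
  shows "kle n K L"
  unfolding kle_def psd_def
proof (intro conjI allI impI)
  fix i j assume "i < n" "j < n"
  then show "L j i - K j i = cnj (L i j - K i j)"
    using psd_hermitian[OF assms(1), of i j] psd_hermitian[OF assms(2), of i j] by simp
qed (use assms(3) in \<open>simp add: mv_kernel_linear ip_linear\<close>)

text \<open>Compare minima: the minimiser for \<open>L\<close> is a competitor for \<open>K\<close>,
  whose form is smaller at every point.\<close>

lemma kle_schur: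
  assumes "psd n K" "psd n L" "kle n K L" "k < n"
  shows "kle n (schur K k) (schur L k)"
proof (intro kle_formI schur_psd assms)
  fix x
  obtain t where t: "Re (ip n (mv n (schur L k) x) x) =
    Re (ip n (mv n L (\<lambda>i. x i - t * idk k i)) (\<lambda>i. x i - t * idk k i))"
    using schur_form_attained[OF assms(2,4)] by blast
  show "Re (ip n (mv n (schur K k) x) x) \<le> Re (ip n (mv n (schur L k) x) x)"
    unfolding t using schur_form_le[OF assms(1,4)] kle_form[OF assms(3)] order_trans by blast
qed

text \<open>\<open>cond_in K k\<close> and \<open>cond_out K k\<close> are the kernels of the determinantal measure conditioned
  on the random set containing, respectively avoiding, the point \<open>k\<close>.\<close>

definition cond_in :: "(nat \<Rightarrow> nat \<Rightarrow> complex) \<Rightarrow> nat \<Rightarrow> nat \<Rightarrow> nat \<Rightarrow> complex" where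
  "cond_in K k i j = schur K k i j + idk k i * cnj (idk k j)"

definition cond_out :: "(nat \<Rightarrow> nat \<Rightarrow> complex) \<Rightarrow> nat \<Rightarrow> nat \<Rightarrow> nat \<Rightarrow> complex" where
  "cond_out K k i j = idk i j - cond_in (\<lambda>i j. idk i j - K i j) k i j"

section \<open>Conditioning preserves contractions and their order\<close>

lemma psd_idk: "psd n idk"
  by (rule psdI_form) (simp add: ip_mv_idk less_eq_complex_def ip_self sum_nonneg)

lemma contraction_complement: "contraction n K \<Longrightarrow> contraction n (\<lambda>i j. idk i j - K i j)"
  by (simp add: contraction_def)

lemma kle_complement: "kle n K L \<Longrightarrow> kle n (\<lambda>i j. idk i j - L i j) (\<lambda>i j. idk i j - K i j)"
  by (simp add: kle_def)

lemma contractionI: "psd n K \<Longrightarrow> kle n K idk \<Longrightarrow> contraction n K"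
  by (simp add: contraction_def kle_def)

lemma contraction_cond_in:
  assumes "contraction n K" "k < n"
  shows "contraction n (cond_in K k)"
proof -
  have K: "psd n K" "kle n K idk" using assms by (auto simp: contraction_def kle_def)
  have p: "psd n (cond_in K k)" unfolding cond_in_def
    by (intro psd_add[OF _ psd_rank_one] schur_psd[OF K(1) assms(2)])
  moreover have "kle n (cond_in K k) idk"
  proof (intro kle_formI p psd_idk)
    fix x
    \<comment> \<open>The competitor with vanishing \<open>k\<close>-th coordinate: its squared norm
      loses exactly the term |x_k|^2 that the rank-one part of \<open>cond_in K k\<close>
      adds.\<close>
    let ?x = "\<lambda>i. x i - x k * idk k i"
    have "Re (ip n (mv n (schur K k) x) x) \<le> Re (ip n (mv n K ?x) ?x)"
      by (rule schur_form_le[OF K(1) assms(2)])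
    also have "\<dots> \<le> Re (ip n (mv n idk ?x) ?x)" by (rule kle_form[OF K(2)])
    also have "ip n (mv n idk ?x) ?x = ip n x x - x k * cnj (x k)"
      using assms(2) by (simp add: ip_mv_idk ip_linear ip_idk_right ip_idk_left idk_same)
    finally have "Re (ip n (mv n (schur K k) x) x) \<le> Re (ip n x x) - Re (x k * cnj (x k))" by simp
    then show "Re (ip n (mv n (cond_in K k) x) x) \<le> Re (ip n (mv n idk x) x)"
      using assms(2) by (simp add: cond_in_def[abs_def] mv_kernel_linear mv_rank_one ip_mv_idk ip_linear
          ip_idk_right ip_idk_left)
  qed
  ultimately show ?thesis by (rule contractionI)
qed

lemma contraction_cond_out:
  assumes "contraction n K" "k < n"
  shows "contraction n (cond_out K k)"
  unfolding cond_out_def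
  by (intro contraction_complement contraction_cond_in assms)

lemma kle_cond_in:
  assumes "psd n K" "psd n L" "kle n K L" "k < n"
  shows "kle n (cond_in K k) (cond_in L k)"
  using kle_schur[OF assms] by (simp add: kle_def cond_in_def)

lemma kle_cond_out:
  assumes "contraction n K" "contraction n L" "kle n K L" "k < n"
  shows "kle n (cond_out K k) (cond_out L k)"
  unfolding cond_out_def
  by (intro kle_complement kle_cond_in assms) (use assms in \<open>auto simp: contraction_def\<close>)

lemma contraction_diag:
  assumes "contraction n K" "k < n"
  shows "K k k = of_real (Re (K k k))" "0 \<le> Re (K k k)" "Re (K k k) \<le> 1"
  using psd_diag[of n K k] psd_diag[of n "\<lambda>i j. idk i j - K i j" k] assms
  by (auto simp: contraction_def idk_def)

text \<open>A coordinate of density 0 or 1 is decoupled, because \<open>K\<close> or I - K has a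
  zero on its diagonal there.\<close>

lemma contraction_frozen_entries:
  assumes "contraction n K" "k < n" "K k k = 0 \<or> K k k = 1" "j < n" "j \<noteq> k"
  shows "K k j = 0" "K j k = 0"
  using psd_zero_diag_entries[of n K k j] psd_zero_diag_entries[of n "\<lambda>i j. idk i j - K i j" k j] assms
  by (auto simp: contraction_def idk_def)

subsection \<open>Determinants and weights\<close>

definition kdet :: "nat \<Rightarrow> (nat \<Rightarrow> nat \<Rightarrow> complex) \<Rightarrow> complex" where
  "kdet n f = Determinant.det (mat n n (\<lambda>(i, j). f i j))"

lemma kdet_cong:
  assumes "\<And>i j. i < n \<Longrightarrow> j < n \<Longrightarrow> f i j = g i j" shows "kdet n f = kdet n g"
  unfolding kdet_def by (rule arg_cong[where f=Determinant.det]) (use assms in auto)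

lemma kdet_transpose: "kdet n (\<lambda>i j. f j i) = kdet n f"
proof -
  have "mat n n (\<lambda>(i, j). f j i) = transpose_mat (mat n n (\<lambda>(i, j). f i j))" by auto
  then show ?thesis unfolding kdet_def by (metis Determinant.det_transpose mat_carrier)
qed

text \<open>In this column form, scaling and splitting columns acts factor by factor;
  \<open>det_def'\<close> is in row form, hence the transpose.\<close>

lemma kdet_leibniz: "kdet n f = (\<Sum>p | p permutes {..<n}. signof p * (\<Prod>j<n. f (p j) j))"
proof -
  have "kdet n f = kdet n (\<lambda>i j. f j i)" by (rule kdet_transpose[symmetric])
  also have "\<dots> = (\<Sum>p | p permutes {0..<n}. signof p * (\<Prod>j = 0..<n. mat n n (\<lambda>(i, j). f j i) $$ (j, p j)))"
    unfolding kdet_def by (rule det_def') simp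
  also have "\<dots> = (\<Sum>p | p permutes {0..<n}. signof p * (\<Prod>j = 0..<n. f (p j) j))"
  proof (intro sum.cong arg_cong2[where f="(*)"] prod.cong refl)
    fix p j assume "p \<in> {p. p permutes {0..<n}}" "j \<in> {0..<n}"
    then have "j < n" "p j < n" using permutes_in_image[of p "{0..<n}" j] by auto
    then show "mat n n (\<lambda>(i, j). f j i) $$ (j, p j) = f (p j) j" by simp
  qed
  finally show ?thesis by (simp add: atLeast0LessThan)
qed

lemma kdet_mult: "kdet n (\<lambda>i j. \<Sum>l<n. f i l * g l j) = kdet n f * kdet n g"
proof -
  have "mat n n (\<lambda>(i, j). \<Sum>l<n. f i l * g l j) = mat n n (\<lambda>(i, j). f i j) * mat n n (\<lambda>(i, j). g i j)"
    by (rule eq_matI) (auto simp: scalar_prod_def atLeast0LessThan)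
  then show ?thesis unfolding kdet_def by (simp add: Determinant.det_mult[of _ n])
qed

lemma kdet_unit_cols:
  assumes "k < n" "\<And>i j. i < n \<Longrightarrow> j < n \<Longrightarrow> j \<noteq> k \<Longrightarrow> f i j = idk i j"
  shows "kdet n f = f k k"
proof -
  have z: "(\<Prod>j<n. f (p j) j) = 0" if p: "p permutes {..<n}" "p \<noteq> id" for p
  proof -
    have "\<exists>j<n. j \<noteq> k \<and> p j \<noteq> j"
    proof (rule ccontr)
      assume "\<not> ?thesis"
      then have pj: "p j = j" if "j \<noteq> k" for j
        using that p(1) by (metis lessThan_iff permutes_not_in)
      then have "p k = k" using p(1) by (metis permutes_inv_eq)
      then have "p = id" using pj by (metis eq_id_iff)
      then show False using p(2) by simp
    qed
    then obtain j where j: "j < n" "j \<noteq> k" "p j \<noteq> j" by blast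
    moreover have "p j < n" using p(1) j(1) permutes_in_image[of p "{..<n}" j] by simp
    ultimately have "f (p j) j = 0" using assms(2)[of "p j" j] by (simp add: idk_def)
    then show ?thesis using j(1) by (intro prod_zero) auto
  qed
  have "kdet n f = (\<Sum>p \<in> {id}. signof p * (\<Prod>j<n. f (p j) j))"
    unfolding kdet_leibniz by (rule sum.mono_neutral_right) (auto simp: z permutes_id finite_permutations)
  also have "\<dots> = (\<Prod>j<n. f j j)" by simp
  also have "\<dots> = f k k * (\<Prod>j\<in>{..<n}-{k}. f j j)" using assms(1) by (simp add: prod.remove)
  also have "(\<Prod>j\<in>{..<n}-{k}. f j j) = 1" using assms(2) by (intro prod.neutral) (auto simp: idk_def)
  finally show ?thesis by simp
qed

lemma kdet_unit_rows:
  assumes "k < n" "\<And>i j. i < n \<Longrightarrow> j < n \<Longrightarrow> i \<noteq> k \<Longrightarrow> f i j = idk i j"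
  shows "kdet n f = f k k"
  using kdet_unit_cols[of k n "\<lambda>i j. f j i"] assms kdet_transpose[of n f] by (simp add: idk_def eq_commute)

lemma kdet_idk: "kdet n idk = 1"
proof -
  have "mat n n (\<lambda>(i, j). idk i j) = 1\<^sub>m n" by (auto simp: idk_def)
  then show ?thesis by (simp add: kdet_def)
qed

lemma kdet_diag:
  assumes "\<And>i j. i < n \<Longrightarrow> j < n \<Longrightarrow> i \<noteq> j \<Longrightarrow> f i j = 0"
  shows "kdet n f = (\<Prod>j<n. f j j)"
proof -
  have z: "(\<Prod>j<n. f (p j) j) = 0" if p: "p permutes {..<n}" "p \<noteq> id" for p
  proof -
    obtain j where j: "p j \<noteq> j" using p(2) by (auto simp: fun_eq_iff)
    then have "j < n" using p(1) by (metis lessThan_iff permutes_not_in)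
    moreover have "p j < n" using p(1) \<open>j < n\<close> permutes_in_image[of p "{..<n}" j] by simp
    ultimately have "f (p j) j = 0" using assms[of "p j" j] j by simp
    then show ?thesis using \<open>j < n\<close> by (intro prod_zero) auto
  qed
  have "kdet n f = (\<Sum>p \<in> {id}. signof p * (\<Prod>j<n. f (p j) j))"
    unfolding kdet_leibniz by (rule sum.mono_neutral_right) (auto simp: z permutes_id finite_permutations)
  then show ?thesis by simp
qed

lemma kdet_zero_col:
  assumes "k < n" "\<And>i. i < n \<Longrightarrow> f i k = 0"
  shows "kdet n f = 0"
  unfolding kdet_leibniz
proof (rule sum.neutral, intro ballI)
  fix p assume "p \<in> {p. p permutes {..<n}}"
  then have "p k < n" using assms(1) permutes_in_image[of p "{..<n}" k] by simp
  then have "(\<Prod>j<n. f (p j) j) = 0" using assms by (intro prod_zero) auto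
  then show "signof p * (\<Prod>j<n. f (p j) j) = 0" by simp
qed

lemma kdet_equal_cols:
  assumes "k < n" "l < n" "k \<noteq> l" "\<And>i. i < n \<Longrightarrow> f i k = f i l"
  shows "kdet n f = 0"
  unfolding kdet_def
  by (rule det_identical_columns[of _ n k l]) (use assms in \<open>auto intro!: eq_vecI\<close>)

text \<open>Multilinearity in the columns: \<open>T\<close> records where the summand with
  \<open>z j\<close> is chosen.\<close>

lemma kdet_expand:
  "kdet n (\<lambda>i j. z j * f i j + g i j) =
    (\<Sum>T\<in>Pow {..<n}. (\<Prod>j\<in>T. z j) * kdet n (\<lambda>i j. if j \<in> T then f i j else g i j))"
proof -
  have "(\<Prod>j<n. z j * f (p j) j + g (p j) j) =
    (\<Sum>T\<in>Pow {..<n}. (\<Prod>j\<in>T. z j) * (\<Prod>j<n. if j \<in> T then f (p j) j else g (p j) j))" for p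
  proof -
    have "(\<Prod>j\<in>T. z j * f (p j) j) * (\<Prod>j\<in>{..<n} - T. g (p j) j) =
      (\<Prod>j\<in>T. z j) * (\<Prod>j<n. if j \<in> T then f (p j) j else g (p j) j)" if "T \<subseteq> {..<n}" for T
    proof -
      have "(\<Prod>j<n. if j \<in> T then f (p j) j else g (p j) j) =
        (\<Prod>j\<in>T. f (p j) j) * (\<Prod>j\<in>{..<n} - T. g (p j) j)"
        using that by (simp add: prod.If_cases Int_absorb1 Diff_eq)
      then show ?thesis by (simp add: prod.distrib mult.assoc)
    qed
    then show ?thesis by (subst prod_add) (auto intro!: sum.cong)
  qed
  then have "kdet n (\<lambda>i j. z j * f i j + g i j) = (\<Sum>p | p permutes {..<n}. \<Sum>T\<in>Pow {..<n}.
    (\<Prod>j\<in>T. z j) * (signof p * (\<Prod>j<n. if j \<in> T then f (p j) j else g (p j) j)))"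
    by (simp add: kdet_leibniz sum_distrib_left mult_ac)
  also have "\<dots> = (\<Sum>T\<in>Pow {..<n}. \<Sum>p | p permutes {..<n}.
    (\<Prod>j\<in>T. z j) * (signof p * (\<Prod>j<n. if j \<in> T then f (p j) j else g (p j) j)))"
    by (rule sum.swap)
  finally show ?thesis by (simp add: kdet_leibniz sum_distrib_left)
qed

text \<open>The matrix determinant lemma. In the column expansion two columns equal to
  \<open>y\<close> kill the determinant, so only the empty set and singletons survive.\<close>

lemma kdet_rank_one_update: "kdet n (\<lambda>i j. idk i j + y i * c j) = 1 + (\<Sum>j<n. c j * y j)"
proof -
  let ?D = "\<lambda>T. kdet n (\<lambda>i j. if j \<in> T then y i else idk i j)"
  have z: "?D T = 0" if T: "T \<in> Pow {..<n} - insert {} ((\<lambda>j. {j}) ` {..<n})" for T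
  proof -
    from T obtain k where k: "k \<in> T" "k < n" by blast
    have "T \<noteq> {k}" using T k by blast
    then obtain l where l: "l \<in> T" "l \<noteq> k" using k by blast
    then have "l < n" using T by blast
    then show ?thesis using k l by (intro kdet_equal_cols[of k n l]) auto
  qed
  have s: "?D {j} = y j" if "j < n" for j using that by (subst kdet_unit_cols[of j]) auto
  have "kdet n (\<lambda>i j. idk i j + y i * c j) = (\<Sum>T\<in>Pow {..<n}. (\<Prod>j\<in>T. c j) * ?D T)"
    using kdet_expand[of n c "\<lambda>i j. y i" idk] by (simp add: add.commute mult.commute)
  also have "\<dots> = (\<Sum>T\<in>insert {} ((\<lambda>j. {j}) ` {..<n}). (\<Prod>j\<in>T. c j) * ?D T)"
    by (rule sum.mono_neutral_right) (use z in auto)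
  also have "\<dots> = ?D {} + (\<Sum>T\<in>(\<lambda>j. {j}) ` {..<n}. (\<Prod>j\<in>T. c j) * ?D T)"
    by (subst sum.insert) auto
  also have "(\<Sum>T\<in>(\<lambda>j. {j}) ` {..<n}. (\<Prod>j\<in>T. c j) * ?D T) = (\<Sum>j<n. c j * ?D {j})"
    by (subst sum.reindex) (auto simp: inj_on_def)
  also have "\<dots> = (\<Sum>j<n. c j * y j)" by (intro sum.cong refl) (use s in auto)
  finally show ?thesis using kdet_idk by simp
qed

lemma kdet_eq_0_kernel:
  assumes "kdet n f = 0"
  obtains v where "\<exists>i<n. v i \<noteq> 0" "\<And>i. i < n \<Longrightarrow> mv n f v i = 0"
proof -
  let ?A = "mat n n (\<lambda>(i, j). f i j)"
  from assms obtain v where v: "v \<in> carrier_vec n" "v \<noteq> 0\<^sub>v n" "?A *\<^sub>v v = 0\<^sub>v n"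
    unfolding kdet_def by (subst (asm) det_0_iff_vec_prod_zero_field[of _ n]) auto
  show thesis
  proof
    show "\<exists>i<n. vec_index v i \<noteq> 0"
    proof (rule ccontr)
      assume "\<not> ?thesis"
      then have "v = 0\<^sub>v n" using v(1) by (intro eq_vecI) auto
      then show False using v(2) by simp
    qed
    fix i assume i: "i < n"
    have "vec_index (?A *\<^sub>v v) i = 0" using v(3) i by simp
    then show "mv n f (vec_index v) i = 0" using i v(1)
      by (simp add: mv_def scalar_prod_def atLeast0LessThan)
  qed
qed

lemma kdet_inverse:
  assumes "kdet n f \<noteq> 0"
  obtains R where "\<And>i j. i < n \<Longrightarrow> j < n \<Longrightarrow> (\<Sum>l<n. R i l * f l j) = idk i j"
    "\<And>i j. i < n \<Longrightarrow> j < n \<Longrightarrow> (\<Sum>l<n. f i l * R l j) = idk i j"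
proof -
  let ?A = "mat n n (\<lambda>(i, j). f i j)"
  have A: "?A \<in> carrier_mat n n" by simp
  from det_non_zero_imp_unit[OF A assms[unfolded kdet_def], of "()"]
  obtain B where B: "B \<in> carrier_mat n n" "B * ?A = 1\<^sub>m n" "?A * B = 1\<^sub>m n"
    by (auto simp: Units_def ring_mat_def)
  show thesis
  proof (rule that[of "\<lambda>i j. B $$ (i, j)"])
    fix i j assume ij: "i < n" "j < n"
    have "(B * ?A) $$ (i, j) = idk i j" "(?A * B) $$ (i, j) = idk i j"
      using ij by (simp_all add: B(2,3) idk_def)
    then show "(\<Sum>l<n. B $$ (i, l) * f l j) = idk i j" "(\<Sum>l<n. f i l * B $$ (l, j)) = idk i j"
      using ij B(1) by (auto simp: scalar_prod_def atLeast0LessThan)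
  qed
qed

text \<open>Only the trace of \<open>T\<close> on \<open>{..<n}\<close> matters. Admitting every set
  lets \<open>wt_complement\<close> exchange \<open>K\<close> and I - K by passing to
  \<open>- T\<close>.\<close>

definition wt :: "nat \<Rightarrow> (nat \<Rightarrow> nat \<Rightarrow> complex) \<Rightarrow> nat set \<Rightarrow> complex" where
  "wt n K T = kdet n (\<lambda>i j. if j \<in> T then K i j else idk i j - K i j)"

lemma wt_cong: "(\<And>i j. i < n \<Longrightarrow> j < n \<Longrightarrow> K i j = L i j) \<Longrightarrow> wt n K T = wt n L T"
  unfolding wt_def by (rule kdet_cong) auto

lemma wt_complement: "wt n (\<lambda>i j. idk i j - K i j) T = wt n K (- T)"
  unfolding wt_def by (rule kdet_cong) auto

lemma wt_gen_poly:
  "(\<Sum>T\<in>Pow {..<n}. (\<Prod>j\<in>T. z j) * wt n K T) = kdet n (\<lambda>i j. idk i j + K i j * (z j - 1))"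
proof -
  have "kdet n (\<lambda>i j. idk i j + K i j * (z j - 1)) = kdet n (\<lambda>i j. z j * K i j + (idk i j - K i j))"
    by (rule kdet_cong) (simp add: algebra_simps)
  then show ?thesis by (simp add: kdet_expand wt_def)
qed

text \<open>Unit columns outside \<open>S\<close> are split as K + (I - K), columns in
  \<open>S\<close> as K + 0, which removes every \<open>T\<close> not containing \<open>S\<close>.
  The right-hand side is the principal minor of \<open>S\<close>, so the weights are the point
  masses of the determinantal measure.\<close>

lemma wt_upsum:
  assumes "S \<subseteq> {..<n}"
  shows "(\<Sum>T | T \<subseteq> {..<n} \<and> S \<subseteq> T. wt n K T) = kdet n (\<lambda>i j. if j \<in> S then K i j else idk i j)"
proof -
  let ?g = "\<lambda>i j. if j \<in> S then 0 else idk i j - K i j"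
  have z: "kdet n (\<lambda>i j. if j \<in> T then K i j else ?g i j) = 0" if T: "\<not> S \<subseteq> T" for T
  proof -
    from T obtain k where "k \<in> S" "k \<notin> T" by blast
    then show ?thesis using assms by (intro kdet_zero_col[of k]) auto
  qed
  have w: "kdet n (\<lambda>i j. if j \<in> T then K i j else ?g i j) = wt n K T" if "S \<subseteq> T" for T
    unfolding wt_def by (rule kdet_cong) (use that in auto)
  have "kdet n (\<lambda>i j. if j \<in> S then K i j else idk i j) = kdet n (\<lambda>i j. 1 * K i j + ?g i j)"
    by (rule kdet_cong) simp
  also have "\<dots> = (\<Sum>T\<in>Pow {..<n}. kdet n (\<lambda>i j. if j \<in> T then K i j else ?g i j))"
    by (subst kdet_expand) simp
  also have "\<dots> = (\<Sum>T | T \<subseteq> {..<n} \<and> S \<subseteq> T. kdet n (\<lambda>i j. if j \<in> T then K i j else ?g i j))"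
    by (rule sum.mono_neutral_right) (use z in auto)
  also have "\<dots> = (\<Sum>T | T \<subseteq> {..<n} \<and> S \<subseteq> T. wt n K T)"
    by (rule sum.cong) (use w in auto)
  finally show ?thesis by simp
qed

lemma wt_sum: "(\<Sum>T\<in>Pow {..<n}. wt n K T) = 1"
  using wt_upsum[of "{}" n K] kdet_idk by (simp add: Pow_def)

lemma wt_marginal: "k < n \<Longrightarrow> (\<Sum>T | T \<subseteq> {..<n} \<and> k \<in> T. wt n K T) = K k k"
  using wt_upsum[of "{k}" n K] kdet_unit_cols[of k n "\<lambda>i j. if j = k then K i j else idk i j"] by simp

text \<open>The matrix of the weight factors as \<open>L\<close>, \<open>?M\<close>,
  \<open>X\<close>, with determinants \<open>K k k\<close>, \<open>wt n (cond_in K k) T\<close> and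
  1.\<close>

lemma wt_cond_in:
  assumes "psd n K" "k < n" "k \<in> T"
  shows "wt n K T = K k k * wt n (cond_in K k) T"
proof (cases "K k k = 0")
  case True
  then show ?thesis unfolding wt_def
    using assms by (subst kdet_zero_col[of k]) (auto intro: psd_zero_diag_entries)
next
  case False
  let ?M = "\<lambda>i j. if j \<in> T then cond_in K k i j else idk i j - cond_in K k i j"
  \<comment> \<open>\<open>X\<close> and \<open>L\<close> undo the elimination: \<open>X\<close>
    restores row \<open>k\<close> up to the pivot, \<open>L\<close> restores column \<open>k\<close>
    and the subtracted rank-one part. The sign of \<open>s j\<close> reflects whether column
    \<open>j\<close> is taken from \<open>K\<close> or from I - K.\<close>
  define s where "s j = (if j \<in> T then K k j / K k k else - K k j / K k k)" for j
  define L where "L i j = idk i j + (if j = k then K i k - idk i k else 0)" for i j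
  define X where "X i j = idk i j + (if i = k then (if j = k then 0 else s j) else 0)" for i j
  have row: "?M k j = (if j = k then 1 else 0)" for j
    using assms(3) False by (auto simp: cond_in_def schur_def idk_def)
  have MX: "(\<Sum>l<n. ?M i l * X l j) = ?M i j + ?M i k * (if j = k then 0 else s j)"
    if "i < n" "j < n" for i j
  proof -
    have "(\<Sum>l<n. ?M i l * X l j) = (\<Sum>l<n. (if l = j then ?M i j else 0) +
      (if l = k then ?M i k * (if j = k then 0 else s j) else 0))"
      by (rule sum.cong) (auto simp: X_def idk_def)
    then show ?thesis using that assms(2) by (simp add: sum.distrib)
  qed
  have LY: "(\<Sum>l<n. L i l * Y l) = Y i + (K i k - idk i k) * Y k" if "i < n" for i and Y :: "nat \<Rightarrow> complex"
  proof -
    have "(\<Sum>l<n. L i l * Y l) = (\<Sum>l<n. (if l = i then Y i else 0) +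
      (if l = k then (K i k - idk i k) * Y k else 0))"
      by (rule sum.cong) (auto simp: L_def idk_def algebra_simps)
    then show ?thesis using that assms(2) by (simp add: sum.distrib)
  qed
  have "wt n K T = kdet n (\<lambda>i j. \<Sum>l<n. L i l * (\<Sum>m<n. ?M l m * X m j))"
    unfolding wt_def
  proof (rule kdet_cong)
    fix i j assume ij: "i < n" "j < n"
    have "(\<Sum>l<n. L i l * (\<Sum>m<n. ?M l m * X m j)) =
      (\<Sum>l<n. L i l * (?M l j + ?M l k * (if j = k then 0 else s j)))"
      by (rule sum.cong) (use MX ij in auto)
    also have "\<dots> = ?M i j + ?M i k * (if j = k then 0 else s j) + (K i k - idk i k) *
      (?M k j + ?M k k * (if j = k then 0 else s j))"
      by (rule LY[OF ij(1)])
    also have "\<dots> = (if j \<in> T then K i j else idk i j - K i j)"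
      unfolding row using False assms(3)
      by (auto simp: cond_in_def schur_def idk_def s_def field_simps)
    finally show "(if j \<in> T then K i j else idk i j - K i j) =
      (\<Sum>l<n. L i l * (\<Sum>m<n. ?M l m * X m j))" by simp
  qed
  also have "\<dots> = kdet n L * (kdet n ?M * kdet n X)" by (simp only: kdet_mult)
  also have "kdet n L = K k k"
    using kdet_unit_cols[OF assms(2), of L] by (simp add: L_def idk_def)
  also have "kdet n X = 1"
    using kdet_unit_rows[OF assms(2), of X] by (simp add: X_def idk_def)
  finally show ?thesis by (simp add: wt_def)
qed

lemma wt_cond_in_0:
  assumes "psd n K" "k < n" "k \<notin> T"
  shows "wt n (cond_in K k) T = 0"
  unfolding wt_def
proof (rule kdet_zero_col[OF assms(2)])
  fix i assume i: "i < n"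
  have "K k k = 0 \<Longrightarrow> K i k = 0" using psd_zero_diag_entries(2)[OF assms(1,2) _ i] .
  then show "(if k \<in> T then cond_in K k i k else idk i k - cond_in K k i k) = 0"
    using assms(3) by (cases "K k k = 0") (simp_all add: cond_in_def schur_def idk_def)
qed

lemma wt_cond_out:
  assumes "contraction n K" "k < n" "k \<notin> T"
  shows "wt n K T = (1 - K k k) * wt n (cond_out K k) T"
  using wt_cond_in[of n "\<lambda>i j. idk i j - K i j" k "- T"] assms
    wt_complement[of n K "- T"] wt_complement[of n "cond_in (\<lambda>i j. idk i j - K i j) k" T]
  by (simp add: contraction_def cond_out_def[abs_def] idk_same)

lemma wt_cond_out_0:
  assumes "contraction n K" "k < n" "k \<in> T"
  shows "wt n (cond_out K k) T = 0"
  using wt_cond_in_0[of n "\<lambda>i j. idk i j - K i j" k "- T"] assms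
    wt_complement[of n "cond_in (\<lambda>i j. idk i j - K i j) k" T]
  by (simp add: cond_out_def[abs_def] contraction_def)

subsection \<open>Expectations and reweighting\<close>

text \<open>Coordinates outside \<open>U\<close> are deterministic. As conditioning keeps the size
  \<open>n\<close>, inductions on the number of random coordinates run over
  \<open>U\<close>.\<close>

definition frozen :: "nat \<Rightarrow> (nat \<Rightarrow> nat \<Rightarrow> complex) \<Rightarrow> nat set \<Rightarrow> bool" where
  "frozen n K U \<longleftrightarrow> (\<forall>j<n. j \<notin> U \<longrightarrow> K j j = 0 \<or> K j j = 1)"

lemma frozen_complement: "frozen n (\<lambda>i j. idk i j - K i j) U \<longleftrightarrow> frozen n K U"
  by (auto simp: frozen_def idk_def)

lemma cond_in_diag: "cond_in K k k k = 1"
  by (simp add: cond_in_def schur_def idk_def)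

text \<open>Conditioning makes \<open>k\<close> deterministic and leaves frozen diagonal entries
  alone, since they are decoupled from \<open>k\<close>.\<close>

lemma frozen_cond_in:
  assumes "contraction n K" "k < n" "frozen n K (insert k U)"
  shows "frozen n (cond_in K k) U"
  unfolding frozen_def
proof (intro allI impI)
  fix j assume j: "j < n" "j \<notin> U"
  show "cond_in K k j j = 0 \<or> cond_in K k j j = 1"
  proof (cases "j = k")
    case False
    then have d: "K j j = 0 \<or> K j j = 1" using assms(3) j by (auto simp: frozen_def)
    have "K j k = 0" using contraction_frozen_entries(1)[OF assms(1) j(1) d assms(2)] False by auto
    then have "cond_in K k j j = K j j" using False by (simp add: cond_in_def schur_def idk_def)
    then show ?thesis using d by simp
  qed (simp add: cond_in_diag)
qed

lemma frozen_cond_out: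
  assumes "contraction n K" "k < n" "frozen n K (insert k U)"
  shows "frozen n (cond_out K k) U"
  unfolding cond_out_def frozen_complement
  by (rule frozen_cond_in) (simp_all add: contraction_complement frozen_complement assms)

definition pr :: "nat \<Rightarrow> (nat \<Rightarrow> nat \<Rightarrow> complex) \<Rightarrow> nat set \<Rightarrow> real" where
  "pr n K T = Re (wt n K T)"

lemma wt_frozen:
  assumes "contraction n K" "frozen n K {}"
  shows "wt n K T = (if T \<inter> {..<n} = {j. j < n \<and> K j j = 1} then 1 else 0)"
proof -
  have off: "K i j = 0" if "i < n" "j < n" "i \<noteq> j" for i j
    using that assms(2) by (intro contraction_frozen_entries(1)[OF assms(1)]) (auto simp: frozen_def)
  have "wt n K T = (\<Prod>j<n. if j \<in> T then K j j else idk j j - K j j)"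
    unfolding wt_def by (rule kdet_diag) (simp add: off idk_def)
  also have "\<dots> = (\<Prod>j<n. if j \<in> T then K j j else 1 - K j j)"
    by (simp only: idk_same)
  also have "\<dots> = (if T \<inter> {..<n} = {j. j < n \<and> K j j = 1} then 1 else 0)"
  proof (cases "T \<inter> {..<n} = {j. j < n \<and> K j j = 1}")
    case True
    then have "(\<Prod>j<n. if j \<in> T then K j j else 1 - K j j) = 1"
      by (intro prod.neutral) (use assms(2) in \<open>auto simp: frozen_def\<close>)
    then show ?thesis using True by simp
  next
    case False
    then obtain j where "j < n" "\<not> (j \<in> T \<longleftrightarrow> K j j = 1)" by auto
    then have "(\<Prod>j<n. if j \<in> T then K j j else 1 - K j j) = 0"
      by (intro prod_zero) (use assms(2) in \<open>auto simp: frozen_def\<close>)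
    then show ?thesis using False by simp
  qed
  finally show ?thesis .
qed

lemma wt_split:
  assumes "contraction n K" "k < n"
  shows "wt n K T = K k k * wt n (cond_in K k) T + (1 - K k k) * wt n (cond_out K k) T"
  using wt_cond_in[of n K k T] wt_cond_in_0[of n K k T] wt_cond_out[of n K k T] wt_cond_out_0[of n K k T] assms
  by (cases "k \<in> T") (simp_all add: contraction_def)

text \<open>Condition on one coordinate after another: the weights are convex combinations of those
  of frozen kernels, which are point masses.\<close>

lemma wt_real_nonneg:
  assumes "contraction n K"
  shows "wt n K T = of_real (pr n K T)" "0 \<le> pr n K T"
proof -
  have "wt n K T = of_real (pr n K T) \<and> 0 \<le> pr n K T"
    if "finite U" "contraction n K" "frozen n K U" for U
    using that
  proof (induction U arbitrary: K rule: finite_induct)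
    case empty
    then show ?case by (simp add: wt_frozen pr_def)
  next
    case (insert k U)
    show ?case
    proof (cases "k < n")
      case False
      then have "frozen n K U" using insert.prems by (auto simp: frozen_def)
      then show ?thesis using insert by blast
    next
      case True
      obtain r where r: "K k k = of_real r" "0 \<le> r" "r \<le> 1"
        by (rule that) (rule contraction_diag[OF insert.prems(1) True])+
      have i: "wt n (cond_in K k) T = of_real (pr n (cond_in K k) T) \<and> 0 \<le> pr n (cond_in K k) T"
        by (intro insert.IH contraction_cond_in frozen_cond_in insert.prems True)
      have o: "wt n (cond_out K k) T = of_real (pr n (cond_out K k) T) \<and> 0 \<le> pr n (cond_out K k) T"
        by (intro insert.IH contraction_cond_out frozen_cond_out insert.prems True)
      have "wt n K T = of_real (r * pr n (cond_in K k) T + (1 - r) * pr n (cond_out K k) T)"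
        unfolding wt_split[OF insert.prems(1) True, of T] using i o r by simp
      moreover from this have "pr n K T = r * pr n (cond_in K k) T + (1 - r) * pr n (cond_out K k) T"
        unfolding pr_def[of n K] by (simp only: Re_complex_of_real)
      ultimately show ?thesis using i o r by simp
    qed
  qed
  from this[of "{..<n}"] assms show "wt n K T = of_real (pr n K T)" "0 \<le> pr n K T"
    by (simp_all add: frozen_def)
qed

section \<open>Expectations under the measure of a kernel\<close>

definition expect :: "nat \<Rightarrow> (nat \<Rightarrow> nat \<Rightarrow> complex) \<Rightarrow> (nat set \<Rightarrow> real) \<Rightarrow> real" where
  "expect n K f = (\<Sum>T\<in>Pow {..<n}. pr n K T * f T)"

lemma expect_diff: "expect n K (\<lambda>T. f T - g T) = expect n K f - expect n K g"
  by (simp add: expect_def algebra_simps sum_subtractf)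

lemma expect_scale: "expect n K (\<lambda>T. c * f T) = c * expect n K f"
  by (simp add: expect_def algebra_simps sum_distrib_left)

lemma expect_const: "expect n K (\<lambda>_. c) = c"
proof -
  have "(\<Sum>T\<in>Pow {..<n}. pr n K T) = 1"
    unfolding pr_def Re_sum[symmetric] wt_sum by simp
  then show ?thesis by (simp add: expect_def sum_distrib_right[symmetric])
qed

lemma expect_mem:
  assumes "k < n" shows "expect n K (\<lambda>T. of_bool (k \<in> T)) = Re (K k k)"
proof -
  have "expect n K (\<lambda>T. of_bool (k \<in> T)) = (\<Sum>T | T \<subseteq> {..<n} \<and> k \<in> T. pr n K T)"
    unfolding expect_def by (rule sum.mono_neutral_cong_right) auto
  then show ?thesis by (simp add: pr_def Re_sum[symmetric] wt_marginal[OF assms])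
qed

lemma pr_split:
  assumes "contraction n K" "k < n"
  shows "pr n K T = Re (K k k) * pr n (cond_in K k) T + (1 - Re (K k k)) * pr n (cond_out K k) T"
proof -
  have "Im (K k k) = 0" using contraction_diag(1)[OF assms] by (metis Im_complex_of_real)
  then show ?thesis unfolding pr_def wt_split[OF assms, of T] by simp
qed

lemma pr_cond_in_0:
  "contraction n K \<Longrightarrow> k < n \<Longrightarrow> k \<notin> T \<Longrightarrow> pr n (cond_in K k) T = 0"
  by (simp add: pr_def wt_cond_in_0 contraction_def)

lemma pr_cond_out_0:
  "contraction n K \<Longrightarrow> k < n \<Longrightarrow> k \<in> T \<Longrightarrow> pr n (cond_out K k) T = 0"
  by (simp add: pr_def wt_cond_out_0)

lemma expect_cond:
  assumes "contraction n K" "k < n"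
  shows "expect n K f = Re (K k k) * expect n (cond_in K k) f + (1 - Re (K k k)) * expect n (cond_out K k) f"
  unfolding expect_def pr_split[OF assms]
  by (simp add: sum_distrib_left sum.distrib[symmetric] algebra_simps)

lemma expect_mem_mult:
  assumes "contraction n K" "k < n"
  shows "expect n K (\<lambda>T. of_bool (k \<in> T) * f T) = Re (K k k) * expect n (cond_in K k) f"
proof -
  have "pr n K T * (of_bool (k \<in> T) * f T) = Re (K k k) * (pr n (cond_in K k) T * f T)" for T
    using pr_split[OF assms, of T] pr_cond_in_0[OF assms, of T] pr_cond_out_0[OF assms, of T]
    by (cases "k \<in> T") auto
  then show ?thesis by (simp only: expect_def sum_distrib_left)
qed

lemma expect_frozen:
  assumes "contraction n K" "frozen n K {}"
  shows "expect n K f = f {j. j < n \<and> K j j = 1}"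
proof -
  have "expect n K f = (\<Sum>T\<in>{{j. j < n \<and> K j j = 1}}. pr n K T * f T)"
    unfolding expect_def
    by (rule sum.mono_neutral_right) (auto simp: pr_def wt_frozen[OF assms] Int_absorb2)
  also have "\<dots> = f {j. j < n \<and> K j j = 1}"
    by (simp add: pr_def wt_frozen[OF assms] Int_absorb2 subset_eq)
  finally show ?thesis .
qed

lemma kle_diag: "kle n K L \<Longrightarrow> k < n \<Longrightarrow> Re (K k k) \<le> Re (L k k)"
  using kle_form[of n K L "idk k"] by (simp add: mv_idk_right ip_idk_right)

lemma kle_frozen:
  assumes "contraction n K" "contraction n L" "kle n K L" "k < n" "K k k = 1"
  shows "L k k = 1"
proof -
  have "Re (L k k) = 1"
    using kle_diag[OF assms(3,4)] contraction_diag(3)[OF assms(2,4)] assms(5) by simp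
  then show ?thesis by (subst contraction_diag(1)[OF assms(2,4)]) simp
qed

lemma kdet_scale_cols: "kdet n (\<lambda>i j. s j * f i j) = (\<Prod>j<n. s j) * kdet n f"
  by (simp add: kdet_leibniz prod.distrib sum_distrib_left mult_ac)

text \<open>Reweighting every set \<open>T\<close> by \<open>\<lambda> ^ card T\<close> turns the kernel \<open>K\<close> into
  \<open>\<lambda> K (I + (\<lambda> - 1) K)\<^sup>-\<^sup>1\<close>, which increases with \<open>\<lambda>\<close>. Below, \<open>\<lambda> = 1 + c\<close>.\<close>

lemma tilted_kernel:
  fixes c :: real
  assumes K: "contraction n K" and c: "0 < c"
  defines "Z \<equiv> \<Sum>T\<in>Pow {..<n}. (1 + c) ^ card T * pr n K T"
  obtains L where "contraction n L" "kle n K L" "0 < Z"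
    "\<And>T. T \<subseteq> {..<n} \<Longrightarrow> pr n L T * Z = (1 + c) ^ card T * pr n K T"
proof -
  have pK: "psd n K" and KI: "kle n K idk" using K by (auto simp: contraction_def kle_def)
  \<comment> \<open>\<open>G\<close> is I + c K. Its form is at least the squared norm, hence it has
    an inverse \<open>R\<close>.\<close>
  define G where "G i j = idk i j + of_real c * K i j" for i j
  have mvG: "mv n G x = (\<lambda>i. mv n idk x i + of_real c * mv n K x i)" for x
    unfolding G_def[abs_def] by (simp add: mv_kernel_linear)
  have "kdet n G \<noteq> 0"
  proof
    assume "kdet n G = 0"
    then obtain v where v: "\<exists>i<n. v i \<noteq> 0" "\<And>i. i < n \<Longrightarrow> mv n G v i = 0" by (rule kdet_eq_0_kernel) blast
    have "0 = ip n (mv n G v) v" using v(2) by (simp add: ip_def)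
    also have "\<dots> = ip n v v + of_real c * ip n (mv n K v) v"
      by (simp add: mvG ip_linear ip_mv_idk)
    finally have "0 = Re (ip n v v + of_real c * ip n (mv n K v) v)" by (metis zero_complex.simps(1))
    then have "Re (ip n v v) \<le> 0"
      using mult_nonneg_nonneg[OF less_imp_le[OF c] psd_nonneg[OF pK, of v]] by simp
    then have "(\<Sum>i<n. (cmod (v i))\<^sup>2) = 0" using sum_nonneg[of "{..<n}" "\<lambda>i. (cmod (v i))\<^sup>2"] by (simp add: ip_self)
    then show False using v(1) by (auto simp: sum_nonneg_eq_0_iff)
  qed
  then obtain R where R: "\<And>i j. i < n \<Longrightarrow> j < n \<Longrightarrow> (\<Sum>l<n. R i l * G l j) = idk i j"
    "\<And>i j. i < n \<Longrightarrow> j < n \<Longrightarrow> (\<Sum>l<n. G i l * R l j) = idk i j" by (rule kdet_inverse) blast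
  define L where "L i j = of_real (1 + c) * (\<Sum>l<n. R i l * K l j)" for i j
  have RG: "mv n R (mv n G y) i = y i" if "i < n" for y i
    unfolding mv_compose mv_idk_left[OF that, of y, symmetric] by (rule mv_cong) (simp_all add: R(1) that)
  have GR: "mv n G (mv n R y) i = y i" if "i < n" for y i
    unfolding mv_compose mv_idk_left[OF that, of y, symmetric] by (rule mv_cong) (simp_all add: R(2) that)
  \<comment> \<open>With x = G y and z = K y, the forms of \<open>L\<close>, \<open>K\<close> and I
    at \<open>x\<close> are expressed through a = (K y, y), b = (z, z), d = (K z, z) and e = (y, y).
    Both K <= L and L <= I then reduce to d <= b <= a <= e.\<close>
  have forms: "\<exists>a b d e. 0 \<le> a \<and> b \<le> a \<and> 0 \<le> b \<and> d \<le> b \<and> a \<le> e \<and>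
      ip n (mv n L x) x = of_real ((1 + c) * (a + c * b)) \<and>
      Re (ip n (mv n K x) x) = a + 2 * c * b + c\<^sup>2 * d \<and>
      Re (ip n x x) = e + 2 * c * a + c\<^sup>2 * b" for x
  proof -
    define y where "y = mv n R x"
    define z where "z = mv n K y"
    let ?x = "\<lambda>i. y i + of_real c * z i"
    have xi: "x i = ?x i" if "i < n" for i
      using GR[OF that, of x] that by (simp add: mvG y_def z_def mv_idk_left)
    have Kx: "mv n K x = (\<lambda>i. z i + of_real c * mv n K z i)"
    proof
      fix i
      have "mv n K x i = mv n K ?x i" by (rule mv_cong) (use xi in auto)
      then show "mv n K x i = z i + of_real c * mv n K z i" by (simp add: mv_add mv_scale z_def)
    qed
    have Lx: "mv n L x i = of_real (1 + c) * z i" if "i < n" for i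
    proof -
      have "mv n L x i = of_real (1 + c) * mv n R (mv n K x) i"
        unfolding L_def[abs_def] by (simp only: mv_kernel_scale mv_compose)
      also have "mv n R (mv n K x) i = mv n R (mv n G z) i"
        by (rule mv_cong) (auto simp: Kx mvG mv_idk_left)
      finally show ?thesis using RG[OF that] by simp
    qed
    define a where "a = Re (ip n z y)"
    define b where "b = Re (ip n z z)"
    define d where "d = Re (ip n (mv n K z) z)"
    define e where "e = Re (ip n y y)"
    have ca: "ip n z y = of_real a" unfolding a_def z_def
      by (simp add: complex_eq_iff psd_form_real[OF pK])
    have cb: "ip n z z = of_real b" unfolding b_def by (simp add: ip_self)
    have ca': "ip n y z = of_real a" unfolding ip_commute[of n y z] ca by simp
    have Kzy: "ip n (mv n K z) y = of_real b" using psd_adjoint[OF pK, of z y] cb by (simp add: z_def)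
    \<comment> \<open>The inequality b <= a expresses K^2 <= K: the form of \<open>K\<close> at y -
      z is a - 2 b + d, and d <= b.\<close>
    have "0 \<le> Re (ip n (mv n K (\<lambda>i. y i - z i)) (\<lambda>i. y i - z i))" by (rule psd_nonneg[OF pK])
    then have "0 \<le> a - 2 * b + d"
      by (simp add: mv_diff ip_linear z_def[symmetric] ca cb Kzy d_def)
    moreover have "d \<le> b" using kle_form[OF KI, of z] by (simp add: ip_mv_idk d_def b_def)
    moreover have "a \<le> e" using kle_form[OF KI, of y] by (simp add: ip_mv_idk a_def e_def z_def)
    moreover have "0 \<le> a" using psd_nonneg[OF pK, of y] by (simp add: a_def z_def)
    moreover have "0 \<le> b" by (simp add: b_def Re_ip_self_nonneg)
    moreover have "ip n (mv n L x) x = ip n (\<lambda>i. of_real (1 + c) * z i) ?x"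
      by (rule ip_cong) (use Lx xi in auto)
    then have "ip n (mv n L x) x = of_real ((1 + c) * (a + c * b))"
      by (simp add: ip_linear ca cb algebra_simps)
    moreover have "ip n (mv n K x) x = ip n (\<lambda>i. z i + of_real c * mv n K z i) ?x"
      unfolding Kx by (rule ip_cong) (use xi in auto)
    then have "Re (ip n (mv n K x) x) = a + 2 * c * b + c\<^sup>2 * d"
      by (simp add: ip_linear ca cb Kzy d_def algebra_simps power2_eq_square)
    moreover have "ip n x x = ip n ?x ?x" by (rule ip_cong) (use xi in auto)
    then have "Re (ip n x x) = e + 2 * c * a + c\<^sup>2 * b"
      by (simp add: ip_linear ca ca' cb e_def algebra_simps power2_eq_square)
    ultimately show ?thesis by (intro exI[of _ a] exI[of _ b] exI[of _ d] exI[of _ e]) linarith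
  qed
  have pL: "psd n L"
  proof (rule psdI_form)
    fix x
    obtain a b where "0 \<le> a" "0 \<le> b" "ip n (mv n L x) x = of_real ((1 + c) * (a + c * b))"
      using forms[of x] by blast
    then show "0 \<le> ip n (mv n L x) x" using c by (simp add: less_eq_complex_def)
  qed
  have KL: "kle n K L"
  proof (rule kle_formI[OF pK pL])
    fix x
    obtain a b d where *: "b \<le> a" "d \<le> b" "ip n (mv n L x) x = of_real ((1 + c) * (a + c * b))"
      "Re (ip n (mv n K x) x) = a + 2 * c * b + c\<^sup>2 * d"
      using forms[of x] by blast
    have "0 \<le> c * (a - b) + c\<^sup>2 * (b - d)" using * c by simp
    then show "Re (ip n (mv n K x) x) \<le> Re (ip n (mv n L x) x)"
      unfolding *(3,4) by (simp add: algebra_simps power2_eq_square)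
  qed
  have LI: "kle n L idk"
  proof (rule kle_formI[OF pL psd_idk])
    fix x
    obtain a b e where *: "b \<le> a" "a \<le> e" "ip n (mv n L x) x = of_real ((1 + c) * (a + c * b))"
      "Re (ip n x x) = e + 2 * c * a + c\<^sup>2 * b"
      using forms[of x] by blast
    have "0 \<le> (e - a) + c * (a - b)" using * c by simp
    then show "Re (ip n (mv n L x) x) \<le> Re (ip n (mv n idk x) x)"
      unfolding *(3) ip_mv_idk *(4) by (simp add: algebra_simps power2_eq_square)
  qed
  have cL: "contraction n L" by (rule contractionI[OF pL LI])
  \<comment> \<open>Since R (I - K) = I - L and (1 + c) R K = L, left multiplication by
    \<open>R\<close> produces the columns for \<open>L\<close> from those for \<open>K\<close>,
    scaled by 1 + c on \<open>T\<close>.\<close>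
  have wL: "wt n L T = kdet n R * of_real ((1 + c) ^ card T) * wt n K T" if T: "T \<subseteq> {..<n}" for T
  proof -
    let ?s = "\<lambda>j. if j \<in> T then of_real (1 + c) else (1::complex)"
    let ?M = "\<lambda>i j. if j \<in> T then K i j else idk i j - K i j"
    have "wt n L T = kdet n (\<lambda>i j. \<Sum>l<n. R i l * (?s j * ?M l j))"
      unfolding wt_def
    proof (rule kdet_cong)
      fix i j assume ij: "i < n" "j < n"
      have "(\<Sum>l<n. R i l * (idk l j - K l j)) = (\<Sum>l<n. R i l * G l j) - L i j"
        by (simp add: L_def G_def sum_distrib_left sum_subtractf[symmetric] algebra_simps sum.distrib)
      then show "(if j \<in> T then L i j else idk i j - L i j) = (\<Sum>l<n. R i l * (?s j * ?M l j))"
        using R(1)[OF ij] by (simp add: L_def sum_distrib_left algebra_simps)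
    qed
    also have "\<dots> = kdet n R * ((\<Prod>j<n. ?s j) * kdet n ?M)"
      by (simp only: kdet_mult kdet_scale_cols)
    also have "(\<Prod>j<n. ?s j) = (\<Prod>j\<in>T. ?s j)"
      by (rule prod.mono_neutral_right) (use T in auto)
    also have "\<dots> = of_real ((1 + c) ^ card T)" by simp
    finally show ?thesis by (simp add: wt_def)
  qed
  \<comment> \<open>Total mass 1 on the side of \<open>L\<close> identifies the determinant of
    \<open>R\<close> as 1 / Z.\<close>
  have RZ: "kdet n R * of_real Z = 1"
  proof -
    have "1 = (\<Sum>T\<in>Pow {..<n}. kdet n R * of_real ((1 + c) ^ card T) * wt n K T)"
      using wt_sum[of n L] wL by simp
    then show ?thesis
      by (simp add: Z_def sum_distrib_left wt_real_nonneg(1)[OF K] mult.assoc)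
  qed
  have "(\<Sum>T\<in>Pow {..<n}. pr n K T) \<le> Z"
    unfolding Z_def
  proof (rule sum_mono)
    fix T :: "nat set"
    have "1 \<le> (1 + c) ^ card T" using c by (simp add: one_le_power)
    then show "pr n K T \<le> (1 + c) ^ card T * pr n K T"
      using mult_right_mono[OF _ wt_real_nonneg(2)[OF K]] by fastforce
  qed
  then have Z: "0 < Z" using expect_const[of n K 1] by (simp add: expect_def)
  have "pr n L T * Z = (1 + c) ^ card T * pr n K T" if "T \<subseteq> {..<n}" for T
  proof -
    have "wt n L T * of_real Z = (kdet n R * of_real Z) * of_real ((1 + c) ^ card T) * wt n K T"
      using wL[OF that] by simp
    then have "complex_of_real (pr n L T * Z) = of_real ((1 + c) ^ card T * pr n K T)"
      by (simp add: RZ wt_real_nonneg(1)[OF cL] wt_real_nonneg(1)[OF K])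
    then show ?thesis using of_real_eq_iff by blast
  qed
  then show thesis using that cL KL Z by blast
qed

subsection \<open>Stochastic monotonicity\<close>

text \<open>The Feder-Mihail step: some random coordinate is nonnegatively correlated with
  \<open>f\<close>. Monotonicity of \<open>f\<close> enters through \<open>IH\<close>, the
  comparison with one random coordinate fewer.\<close>

lemma expect_mono_direction:
  assumes K: "contraction n K" "frozen n K U" and U: "U \<subseteq> {..<n}" "U \<noteq> {}"
    and IH: "\<And>k K L. k \<in> U \<Longrightarrow> contraction n K \<Longrightarrow> contraction n L \<Longrightarrow> frozen n K (U - {k}) \<Longrightarrow>
      frozen n L (U - {k}) \<Longrightarrow> kle n K L \<Longrightarrow> expect n K f \<le> expect n L f"
  shows "\<exists>k\<in>U. expect n (cond_out K k) f \<le> expect n (cond_in K k) f"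
proof (rule ccontr)
  \<comment> \<open>For \<open>0 < \<kappa> k\<close> and \<open>\<kappa> k < 1\<close>,
    \<open>c k\<close> is Cov([k in T], f) / Var [k in T].\<close>
  define c where "c k = expect n (cond_in K k) f - expect n (cond_out K k) f" for k
  define \<kappa> where "\<kappa> k = Re (K k k)" for k
  assume "\<not> ?thesis"
  then have neg: "c k < 0" if "k \<in> U" for k using that by (auto simp: c_def not_le)
  have fr: "frozen n K (insert k (U - {k}))" if "k \<in> U" for k using K(2) that by (simp add: insert_absorb)
  have \<kappa>: "0 \<le> \<kappa> k" "\<kappa> k \<le> 1" if "k < n" for k
    using contraction_diag(2,3)[OF K(1) that] by (simp_all add: \<kappa>_def)
  \<comment> \<open>Otherwise \<open>k\<close> would be independent of the other coordinates: the
    two conditioned kernels would differ by a rank-one projection only, and \<open>IH\<close> would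
    give \<open>c k \<ge> 0\<close>.\<close>
  have nonzero: "\<exists>j<n. j \<noteq> k \<and> K j k \<noteq> 0" if k: "k \<in> U" for k
  proof (rule ccontr)
    assume "\<not> ?thesis"
    then have z: "K j k = 0" if "j < n" "j \<noteq> k" for j using that by blast
    have kn: "k < n" using k U by auto
    have z': "K k j = 0" if "j < n" "j \<noteq> k" for j
      using z[OF that] psd_hermitian[of n K j k] K(1) that kn by (simp add: contraction_def)
    have "psd n (\<lambda>i j. cond_in K k i j - cond_out K k i j) \<longleftrightarrow> psd n (\<lambda>i j. idk k i * cnj (idk k j))"
    proof (rule psd_cong)
      fix i j assume ij: "i < n" "j < n"
      show "cond_in K k i j - cond_out K k i j = idk k i * cnj (idk k j)"
      proof (cases "i = k \<and> j = k")
        case False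
        then have "K i k * K k j = 0" "(idk i k - K i k) * (idk k j - K k j) = 0"
          using z z' ij by (auto simp: idk_def)
        then show ?thesis using False by (auto simp: cond_out_def cond_in_def schur_def idk_def)
      qed (simp add: cond_out_def cond_in_diag idk_same)
    qed
    then have "kle n (cond_out K k) (cond_in K k)" by (simp add: kle_def psd_rank_one)
    then have "expect n (cond_out K k) f \<le> expect n (cond_in K k) f"
      by (intro IH[OF k]) (use K(1) kn fr[OF k] in \<open>auto intro: contraction_cond_in contraction_cond_out
          frozen_cond_in frozen_cond_out\<close>)
    then show False using neg[OF k] by (simp add: c_def)
  qed
  from U obtain k where k: "k \<in> U" "k < n" by auto
  \<comment> \<open>\<open>h\<close> is \<open>f\<close> minus its linear regression on [k in T]:
    under \<open>K\<close> it has mean zero and is uncorrelated with [k in T].\<close>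
  define h where "h T = f T - expect n K f - c k * (of_bool (k \<in> T) - \<kappa> k)" for T
  have expect_h: "expect n L h = expect n L f - expect n K f - c k * (Re (L k k) - \<kappa> k)" for L
    unfolding h_def by (simp add: expect_diff expect_scale expect_const expect_mem k(2))
  \<comment> \<open>By \<open>IH\<close>, passing to the tilted kernel \<open>L\<close> lowers
    neither conditional mean of \<open>f\<close> given \<open>k\<close>, so the mean of
    \<open>h\<close> under \<open>L\<close> is nonnegative.\<close>
  have tilt: "0 \<le> (\<Sum>T\<in>Pow {..<n}. (1 + t) ^ card T * (pr n K T * h T))" if t0: "0 < t" for t
  proof -
    define Z where "Z = (\<Sum>T\<in>Pow {..<n}. (1 + t) ^ card T * pr n K T)"
    obtain L where L: "contraction n L" "kle n K L" "0 < Z"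
      "\<And>T. T \<subseteq> {..<n} \<Longrightarrow> pr n L T * Z = (1 + t) ^ card T * pr n K T"
      using tilted_kernel[OF K(1) t0] unfolding Z_def by blast
    \<comment> \<open>Tilting preserves null sets, which keeps density 0; density 1 persists because
      \<open>L\<close> dominates \<open>K\<close>.\<close>
    have frL: "frozen n L U" unfolding frozen_def
    proof (intro allI impI)
      fix j assume j: "j < n" "j \<notin> U"
      show "L j j = 0 \<or> L j j = 1"
      proof (cases "K j j = 0")
        case True
        have "pr n L T * of_bool (j \<in> T) = 0" if T: "T \<subseteq> {..<n}" for T
        proof (cases "j \<in> T")
          case jT: True
          have "pr n K T = 0" using pr_split[OF K(1) j(1), of T] pr_cond_out_0[OF K(1) j(1) jT] True by simp
          then have "pr n L T * Z = 0" using L(4)[OF T] by simp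
          then show ?thesis using L(3) by simp
        qed simp
        then have "expect n L (\<lambda>T. of_bool (j \<in> T)) = 0" unfolding expect_def by (intro sum.neutral) simp
        then have "Re (L j j) = 0" by (simp add: expect_mem j(1))
        then have "L j j = 0" by (subst contraction_diag(1)[OF L(1) j(1)]) simp
        then show ?thesis by simp
      next
        case False
        then have "K j j = 1" using K(2) j by (auto simp: frozen_def)
        then show ?thesis using kle_frozen[OF K(1) L(1,2) j(1)] by simp
      qed
    qed
    define p1 where "p1 = expect n (cond_in K k) f"
    define p0 where "p0 = expect n (cond_out K k) f"
    define q where "q = Re (L k k)"
    have q: "0 \<le> q" "q \<le> 1" using contraction_diag(2,3)[OF L(1) k(2)] by (simp_all add: q_def)
    have frL': "frozen n L (insert k (U - {k}))" using frL k(1) by (simp add: insert_absorb)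
    have "p1 \<le> expect n (cond_in L k) f" unfolding p1_def
      by (intro IH[OF k(1)] contraction_cond_in frozen_cond_in kle_cond_in)
        (use K(1) L(1,2) fr[OF k(1)] frL' k(2) in \<open>auto simp: contraction_def\<close>)
    moreover have "p0 \<le> expect n (cond_out L k) f" unfolding p0_def
      by (intro IH[OF k(1)] contraction_cond_out frozen_cond_out kle_cond_out)
        (use K(1) L(1,2) fr[OF k(1)] frL' k(2) in auto)
    ultimately have "q * p1 + (1 - q) * p0 \<le> expect n L f"
      unfolding expect_cond[OF L(1) k(2), of f] q_def[symmetric]
      using q by (intro add_mono mult_left_mono) auto
    moreover have "expect n K f = \<kappa> k * p1 + (1 - \<kappa> k) * p0"
      unfolding expect_cond[OF K(1) k(2), of f] \<kappa>_def p1_def p0_def ..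
    moreover have ck: "c k = p1 - p0" by (simp add: c_def p1_def p0_def)
    ultimately have "0 \<le> expect n L h" unfolding expect_h q_def[symmetric] ck by (simp add: algebra_simps)
    then have "0 \<le> expect n L h * Z" using L(3) by simp
    also have "expect n L h * Z = (\<Sum>T\<in>Pow {..<n}. (pr n L T * Z) * h T)"
      by (simp add: expect_def sum_distrib_left sum_distrib_right mult_ac)
    also have "\<dots> = (\<Sum>T\<in>Pow {..<n}. (1 + t) ^ card T * (pr n K T * h T))"
      by (rule sum.cong) (use L(4) in auto)
    finally show ?thesis .
  qed
  \<comment> \<open>\<open>F t\<close> is the tilted mean of \<open>h\<close> times the normalising
    constant. As \<open>F\<close> vanishes at 0 and is nonnegative to the right, its derivative at
    0, the mean of card T times h, is nonnegative.\<close>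
  define F where "F t = (\<Sum>T\<in>Pow {..<n}. (1 + t) ^ card T * (pr n K T * h T))" for t :: real
  have F0: "F 0 = 0" using expect_h[of K] by (simp add: F_def expect_def[symmetric] \<kappa>_def)
  have dF: "(F has_real_derivative (\<Sum>T\<in>Pow {..<n}. real (card T) * (pr n K T * h T))) (at 0)"
    unfolding F_def by (auto intro!: derivative_eq_intros)
  have card_h: "0 \<le> (\<Sum>T\<in>Pow {..<n}. real (card T) * (pr n K T * h T))"
  proof (rule ccontr)
    assume "\<not> ?thesis"
    then obtain d where "d > 0" "\<And>t. t > 0 \<Longrightarrow> t < d \<Longrightarrow> F (0 + t) < F 0"
      using DERIV_neg_dec_right[OF dF] by (auto simp: not_le)
    from this(2)[of "d / 2"] this(1) tilt[of "d / 2"] show False by (simp add: F0 F_def[symmetric])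
  qed
  have "(\<Sum>T\<in>Pow {..<n}. real (card T) * (pr n K T * h T)) = (\<Sum>j<n. expect n K (\<lambda>T. of_bool (j \<in> T) * h T))"
  proof -
    have "real (card T) * (pr n K T * h T) = (\<Sum>j<n. pr n K T * (of_bool (j \<in> T) * h T))"
      if "T \<in> Pow {..<n}" for T
    proof -
      have "real (card T) = (\<Sum>j<n. of_bool (j \<in> T))"
        using that by (simp add: Int_absorb1 sum.If_cases of_bool_def)
      then show ?thesis by (simp only: sum_distrib_right sum_distrib_left mult.left_commute)
    qed
    then have "(\<Sum>T\<in>Pow {..<n}. real (card T) * (pr n K T * h T)) =
      (\<Sum>T\<in>Pow {..<n}. \<Sum>j<n. pr n K T * (of_bool (j \<in> T) * h T))"
      by (rule sum.cong[OF refl])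
    also have "\<dots> = (\<Sum>j<n. \<Sum>T\<in>Pow {..<n}. pr n K T * (of_bool (j \<in> T) * h T))" by (rule sum.swap)
    finally show ?thesis by (simp add: expect_def)
  qed
  moreover have summand: "expect n K (\<lambda>T. of_bool (j \<in> T) * h T) =
    \<kappa> j * ((1 - \<kappa> j) * c j - c k * (Re (cond_in K j k k) - \<kappa> k))" if "j < n" for j
  proof -
    have "expect n K f = \<kappa> j * expect n (cond_in K j) f + (1 - \<kappa> j) * expect n (cond_out K j) f"
      unfolding expect_cond[OF K(1) that, of f] \<kappa>_def ..
    then have "expect n (cond_in K j) f - expect n K f = (1 - \<kappa> j) * c j"
      by (simp add: c_def algebra_simps)
    then show ?thesis unfolding expect_mem_mult[OF K(1) that] expect_h \<kappa>_def[symmetric] by simp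
  qed
  \<comment> \<open>Negative correlation: conditioning on \<open>j\<close> lowers the density of
    \<open>k\<close> by |K k j|^2 / K j j. Since \<open>c k < 0\<close>, the correction can only
    decrease the summand.\<close>
  have summand_le: "expect n K (\<lambda>T. of_bool (j \<in> T) * h T) \<le> \<kappa> j * (1 - \<kappa> j) * c j" if j: "j < n" "j \<noteq> k" for j
  proof -
    define r where "r = Re (K j j)"
    have r: "K j j = of_real r" "0 \<le> r" using contraction_diag(1,2)[OF K(1) j(1)] by (simp_all add: r_def)
    have "K j k = cnj (K k j)" using psd_hermitian[of n K k j] K(1) k(2) j by (simp add: contraction_def)
    then have "K k j * K j k / K j j = of_real ((cmod (K k j))\<^sup>2 / r)"
      by (simp add: complex_norm_square[symmetric] r(1))
    then have "Re (cond_in K j k k) = \<kappa> k - (cmod (K k j))\<^sup>2 / r"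
      using j by (simp add: cond_in_def schur_def idk_def \<kappa>_def)
    then have "Re (cond_in K j k k) - \<kappa> k \<le> 0" using r by simp
    then have "0 \<le> c k * (Re (cond_in K j k k) - \<kappa> k)"
      using neg[OF k(1)] by (simp add: mult_nonpos_nonpos)
    then have "(1 - \<kappa> j) * c j - c k * (Re (cond_in K j k k) - \<kappa> k) \<le> (1 - \<kappa> j) * c j" by simp
    from mult_left_mono[OF this \<kappa>(1)[OF j(1)]] show ?thesis unfolding summand[OF j(1)] by (simp add: mult_ac)
  qed
  have summand_k: "expect n K (\<lambda>T. of_bool (k \<in> T) * h T) = 0"
    unfolding summand[OF k(2)] by (simp add: cond_in_diag algebra_simps)
  \<comment> \<open>A coordinate \<open>j\<close> coupled to \<open>k\<close> is not frozen, hence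
    lies in \<open>U\<close> and contributes a strictly negative term.\<close>
  obtain j where j: "j < n" "j \<noteq> k" "K j k \<noteq> 0" using nonzero[OF k(1)] by blast
  have jU: "K j j \<noteq> 0" "K j j \<noteq> 1"
    using contraction_frozen_entries(1)[OF K(1) j(1) _ k(2)] j by auto
  then have "j \<in> U" using K(2) j(1) by (auto simp: frozen_def)
  have "\<kappa> j \<noteq> 0" "\<kappa> j \<noteq> 1" using jU contraction_diag(1)[OF K(1) j(1)] unfolding \<kappa>_def by (metis of_real_0 of_real_1)+
  then have dj: "0 < \<kappa> j * (1 - \<kappa> j)" using \<kappa>[OF j(1)] by simp
  have le0: "expect n K (\<lambda>T. of_bool (i \<in> T) * h T) \<le> 0" if i: "i < n" for i
  proof (cases "i = k \<or> i \<in> U")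
    case True
    have "\<kappa> i * (1 - \<kappa> i) * c i \<le> 0" if "i \<in> U"
      using neg[OF that] \<kappa>[OF i] by (intro mult_nonneg_nonpos) auto
    then show ?thesis using True summand_k summand_le[OF i] by (cases "i = k") auto
  next
    case False
    then have "\<kappa> i = 0 \<or> \<kappa> i = 1" using K(2) i by (auto simp: frozen_def \<kappa>_def)
    then show ?thesis using summand_le[OF i] False by auto
  qed
  have "expect n K (\<lambda>T. of_bool (j \<in> T) * h T) < 0"
    using summand_le[OF j(1,2)] mult_pos_neg[OF dj neg[OF \<open>j \<in> U\<close>]] by simp
  then have "(\<Sum>i<n. expect n K (\<lambda>T. of_bool (i \<in> T) * h T)) < (\<Sum>i<n. 0)"
    using le0 j(1) by (intro sum_strict_mono_ex1) auto
  ultimately show False using card_h by simp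
qed

text \<open>Induction on the random coordinates. At the \<open>k\<close> found above, raising the
  density from \<open>K k k\<close> to \<open>L k k\<close> moves mass to the larger conditional
  mean of \<open>K\<close>, and both conditional means grow from \<open>K\<close> to
  \<open>L\<close> by induction.\<close>

lemma expect_mono:
  assumes "contraction n K" "contraction n L" "kle n K L"
    and f: "\<And>S T. S \<subseteq> T \<Longrightarrow> T \<subseteq> {..<n} \<Longrightarrow> f S \<le> f T"
  shows "expect n K f \<le> expect n L f"
proof -
  have "expect n K f \<le> expect n L f"
    if "U \<subseteq> {..<n}" "contraction n K" "contraction n L" "kle n K L" "frozen n K U" "frozen n L U" for U
  proof -
    have "finite U" using that(1) finite_subset by blast
    then show ?thesis using that
    proof (induction U arbitrary: K L rule: finite_psubset_induct)
      case (psubset U)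
      note KL = psubset.prems
      show ?case
      proof (cases "U = {}")
        case True
        \<comment> \<open>Without random coordinates both measures are point masses, at nested
          sets.\<close>
        have "{j. j < n \<and> K j j = 1} \<subseteq> {j. j < n \<and> L j j = 1}"
          using kle_frozen[OF KL(2-4)] by auto
        then show ?thesis using KL(2-6) by (auto simp: True expect_frozen intro: f)
      next
        case False
        have IH: "expect n K f \<le> expect n L f" if "k \<in> U" "contraction n K" "contraction n L" "frozen n K (U - {k})"
          "frozen n L (U - {k})" "kle n K L" for k K L
          using that KL(1) by (intro psubset.IH[of "U - {k}"]) auto
        have "\<exists>k\<in>U. expect n (cond_out K k) f \<le> expect n (cond_in K k) f"
          by (rule expect_mono_direction[OF KL(2,5,1) False]) (rule IH)
        then obtain k where k: "k \<in> U" "expect n (cond_out K k) f \<le> expect n (cond_in K k) f"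
          by blast
        have kn: "k < n" using k KL(1) by auto
        have fr: "frozen n K (insert k (U - {k}))" "frozen n L (insert k (U - {k}))"
          using KL(5,6) k(1) by (simp_all add: insert_absorb)
        have 1: "expect n (cond_in K k) f \<le> expect n (cond_in L k) f"
          by (intro IH[OF k(1)] contraction_cond_in frozen_cond_in kle_cond_in)
            (use KL fr kn in \<open>auto simp: contraction_def\<close>)
        have 2: "expect n (cond_out K k) f \<le> expect n (cond_out L k) f"
          by (intro IH[OF k(1)] contraction_cond_out frozen_cond_out kle_cond_out) (use KL fr kn in auto)
        have d: "Re (K k k) \<le> Re (L k k)" by (rule kle_diag[OF KL(4) kn])
        have l: "0 \<le> Re (L k k)" "Re (L k k) \<le> 1" using contraction_diag[OF KL(3) kn] by auto
        have "expect n K f = expect n (cond_out K k) f + Re (K k k) * (expect n (cond_in K k) f - expect n (cond_out K k) f)"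
          by (simp add: expect_cond[OF KL(2) kn, of f] algebra_simps)
        also have "\<dots> \<le> expect n (cond_out K k) f + Re (L k k) * (expect n (cond_in K k) f - expect n (cond_out K k) f)"
          using d k(2) by (intro add_left_mono mult_right_mono) auto
        also have "\<dots> = Re (L k k) * expect n (cond_in K k) f + (1 - Re (L k k)) * expect n (cond_out K k) f"
          by (simp add: algebra_simps)
        also have "\<dots> \<le> Re (L k k) * expect n (cond_in L k) f + (1 - Re (L k k)) * expect n (cond_out L k) f"
          using 1 2 l by (intro add_mono mult_left_mono) auto
        also have "\<dots> = expect n L f" by (rule expect_cond[OF KL(3) kn, symmetric])
        finally show ?thesis .
      qed
    qed
  qed
  from this[of "{..<n}"] assms show ?thesis by (simp add: frozen_def)
qed

subsection \<open>Spectral criterion and stability\<close>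

lemma kdet_minor_permutes:
  assumes "S \<subseteq> {..<n}"
  shows "kdet n (\<lambda>i j. if j \<in> S then K i j else idk i j) =
    (\<Sum>p | p permutes S. signof p * (\<Prod>j\<in>S. K (p j) j))"
proof -
  let ?f = "\<lambda>i j. if j \<in> S then K i j else idk i j"
  have z: "(\<Prod>j<n. ?f (p j) j) = 0" if p: "p permutes {..<n}" "\<not> p permutes S" for p
  proof -
    have "\<exists>j\<in>{..<n} - S. p j \<noteq> j"
      using permutes_superset[OF p(1), of S] p(2) by blast
    then obtain j where j: "j < n" "j \<notin> S" "p j \<noteq> j" by blast
    then have "?f (p j) j = 0" by (simp add: idk_def)
    then show ?thesis using j(1) by (intro prod_zero bexI[of _ j]) auto
  qed
  have e: "(\<Prod>j<n. ?f (p j) j) = (\<Prod>j\<in>S. K (p j) j)" if "p permutes S" for p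
  proof -
    have "(\<Prod>j<n. ?f (p j) j) = (\<Prod>j\<in>S. ?f (p j) j)"
      by (rule prod.mono_neutral_right) (use assms permutes_not_in[OF that] in \<open>auto simp: idk_def\<close>)
    then show ?thesis by simp
  qed
  show ?thesis unfolding kdet_leibniz
    by (rule sum.mono_neutral_cong_right)
      (use z e assms in \<open>auto simp: finite_permutations intro: permutes_subset\<close>)
qed

text \<open>\<open>submatrix\<close> renumbers by \<open>pick S\<close>. Conjugation with this
  enumeration turns permutations of \<open>{..<m}\<close> into permutations of \<open>S\<close> of
  the same sign, which matches the Leibniz sums.\<close>

lemma det_submatrix_kdet:
  assumes A: "A \<in> carrier_mat n n" and S: "S \<subseteq> {..<n}"
  shows "Determinant.det (submatrix A S S) = kdet n (\<lambda>i j. if j \<in> S then A $$ (i, j) else idk i j)"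
proof -
  define m where "m = card S"
  have fS: "finite S" using S finite_subset by blast
  have "{i. i < n \<and> i \<in> S} = S" using S by auto
  then have sub: "submatrix A S S = mat m m (\<lambda>(i, j). A $$ (pick S i, pick S j))"
    using A unfolding submatrix_def m_def by auto
  have inj: "inj_on (pick S) {..<m}"
  proof (rule linorder_inj_onI)
    fix a b assume "a < b" "a \<in> {..<m}" "b \<in> {..<m}"
    then show "pick S a \<noteq> pick S b" using pick_mono[of b S a] by (simp add: m_def)
  qed auto
  have im: "pick S ` {..<m} = S"
  proof (rule card_subset_eq[OF fS])
    show "pick S ` {..<m} \<subseteq> S" using pick_in_set[of _ S] by (auto simp: m_def)
    show "card (pick S ` {..<m}) = card S" using card_image[OF inj] by (simp add: m_def)
  qed
  have bij: "bij_betw (pick S) {..<m} S" using inj im by (simp add: bij_betw_def)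
  define g where "g = inv_into {..<m} (pick S)"
  have gbij: "bij_betw g S {..<m}" unfolding g_def by (rule bij_betw_inv_into[OF bij])
  have "Determinant.det (submatrix A S S) = kdet m (\<lambda>i j. A $$ (pick S i, pick S j))"
    by (simp add: sub kdet_def)
  also have "\<dots> = (\<Sum>q | q permutes {..<m}. signof q * (\<Prod>b<m. A $$ (pick S (q b), pick S b)))"
    by (rule kdet_leibniz)
  also have "\<dots> = (\<Sum>p | p permutes S. signof p * (\<Prod>j\<in>S. A $$ (p j, j)))"
  proof (rule sum.reindex_bij_witness[of _ "map_permutation S g" "map_permutation {..<m} (pick S)"])
    fix q assume "q \<in> {q. q permutes {..<m}}"
    then have q: "q permutes {..<m}" by simp
    show "map_permutation S g (map_permutation {..<m} (pick S) q) = q"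
      by (rule map_permutation_compose_inv[OF bij q]) (simp add: g_def inv_into_f_f[OF inj])
    show "map_permutation {..<m} (pick S) q \<in> {p. p permutes S}"
      using map_permutation_permutes[OF bij q] by simp
    have "(\<Prod>j\<in>S. A $$ (map_permutation {..<m} (pick S) q j, j)) = (\<Prod>b<m. A $$ (pick S (q b), pick S b))"
      unfolding prod.reindex_bij_betw[OF bij, symmetric]
      by (intro prod.cong refl) (simp add: map_permutation_apply[OF inj])
    moreover have "sign (map_permutation {..<m} (pick S) q) = sign q"
      by (rule sign_map_permutation[OF inj q]) simp
    ultimately show "signof (map_permutation {..<m} (pick S) q) *
       (\<Prod>j\<in>S. A $$ (map_permutation {..<m} (pick S) q j, j)) =
       signof q * (\<Prod>b<m. A $$ (pick S (q b), pick S b))" by simp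
  next
    fix p assume "p \<in> {p. p permutes S}"
    then have p: "p permutes S" by simp
    show "map_permutation {..<m} (pick S) (map_permutation S g p) = p"
      by (rule map_permutation_compose_inv[OF gbij p]) (simp add: g_def f_inv_into_f im)
    show "map_permutation S g p \<in> {q. q permutes {..<m}}"
      using map_permutation_permutes[OF gbij p] by simp
  qed
  finally show ?thesis by (simp add: kdet_minor_permutes[OF S])
qed

text \<open>If \<open>H + t I\<close> fails to be positive semidefinite at \<open>t = 0\<close>, then it is singular for
  the smallest admissible \<open>t > 0\<close>: were it invertible there, its form would be bounded below and
  \<open>t\<close> could be lowered.\<close>

lemma psd_from_spectrum:
  assumes herm: "\<And>i j. i < n \<Longrightarrow> j < n \<Longrightarrow> H j i = cnj (H i j)"
    and spec: "\<And>t v. 0 < t \<Longrightarrow> (\<And>i. i < n \<Longrightarrow> mv n H v i = - of_real t * v i) \<Longrightarrow> (\<And>i. i < n \<Longrightarrow> v i = 0)"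
  shows "psd n H"
proof -
  define q where "q x = Re (ip n (mv n H x) x)" for x
  define N where "N x = Re (ip n x x)" for x
  have N: "N x = (\<Sum>i<n. (cmod (x i))\<^sup>2)" for x by (simp add: N_def ip_self)
  have N0: "0 \<le> N x" for x by (simp add: N sum_nonneg)
  have coord: "(cmod (x i))\<^sup>2 \<le> N x" if "i < n" for x i
    unfolding N using that by (intro member_le_sum) auto
  define M where "M t i j = H i j + of_real t * idk i j" for t i j
  have form: "Re (ip n (mv n (M t) x) x) = q x + t * N x" for t x
    by (simp add: M_def[abs_def] mv_kernel_linear ip_linear ip_mv_idk q_def N_def)
  have psdM: "psd n (M t) \<longleftrightarrow> (\<forall>x. 0 \<le> q x + t * N x)" for t
  proof -
    have "\<forall>i<n. \<forall>j<n. M t j i = cnj (M t i j)"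
    proof (intro allI impI)
      fix i j assume "i < n" "j < n"
      then show "M t j i = cnj (M t i j)" using herm[of i j] by (simp add: M_def idk_def)
    qed
    then show ?thesis unfolding psd_def form by blast
  qed
  \<comment> \<open>The admissible shifts. The sum of all |H i j| is one of them, so the infimum
    makes sense.\<close>
  define P where "P = {t. 0 \<le> t \<and> (\<forall>x. 0 \<le> q x + t * N x)}"
  have "(\<Sum>i<n. \<Sum>j<n. cmod (H i j)) \<in> P"
    unfolding P_def
  proof (intro CollectI conjI allI)
    show "0 \<le> (\<Sum>i<n. \<Sum>j<n. cmod (H i j))" by (intro sum_nonneg) auto
    fix x
    have "\<bar>q x\<bar> \<le> cmod (ip n (mv n H x) x)" unfolding q_def by (rule abs_Re_le_cmod)
    also have "ip n (mv n H x) x = (\<Sum>i<n. \<Sum>j<n. H i j * x j * cnj (x i))"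
      by (simp add: ip_def mv_def sum_distrib_right)
    also have "cmod \<dots> \<le> (\<Sum>i<n. \<Sum>j<n. cmod (H i j) * N x)"
    proof (intro order_trans[OF norm_sum] sum_mono)
      fix i j assume ij: "i \<in> {..<n}" "j \<in> {..<n}"
      have "2 * (cmod (x j) * cmod (x i)) \<le> (cmod (x i))\<^sup>2 + (cmod (x j))\<^sup>2"
        using sum_squares_bound[of "cmod (x j)" "cmod (x i)"] by (simp add: mult_ac)
      then have "cmod (x j) * cmod (x i) \<le> N x" using coord[of i x] coord[of j x] ij by simp
      then have "cmod (H i j) * (cmod (x j) * cmod (x i)) \<le> cmod (H i j) * N x"
        by (intro mult_left_mono) auto
      then show "norm (H i j * x j * cnj (x i)) \<le> cmod (H i j) * N x" by (simp add: norm_mult mult_ac)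
    qed
    also have "\<dots> = (\<Sum>i<n. \<Sum>j<n. cmod (H i j)) * N x" by (simp add: sum_distrib_right)
    finally show "0 \<le> q x + (\<Sum>i<n. \<Sum>j<n. cmod (H i j)) * N x" by simp
  qed
  then have ne: "P \<noteq> {}" by blast
  have bdd: "bdd_below P" by (rule bdd_belowI[of _ 0]) (simp add: P_def)
  define s where "s = Inf P"
  have s0: "0 \<le> s" unfolding s_def by (rule cInf_greatest[OF ne]) (simp add: P_def)
  have sP: "0 \<le> q x + s * N x" for x
  proof (rule ccontr)
    assume neg: "\<not> ?thesis"
    \<comment> \<open>Raising \<open>s\<close> by \<open>d\<close> repairs at most half of the
      deficit at \<open>x\<close>, yet \<open>P\<close> has an element below s + d. The summand 1
      keeps the denominator positive.\<close>
    define d where "d = - (q x + s * N x) / 2 / (N x + 1)"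
    have "N x + 1 \<noteq> 0" using N0[of x] by linarith
    then have dN: "d * (N x + 1) = - (q x + s * N x) / 2"
      unfolding d_def by (rule nonzero_eq_divide_eq[THEN iffD1, OF _ refl])
    have "d > 0" using neg N0[of x] by (auto simp: d_def divide_neg_pos)
    then obtain t where t: "t \<in> P" "t < s + d" using cInf_lessD[OF ne, of "s + d"] by (auto simp: s_def)
    have "0 \<le> q x + t * N x" using t(1) by (simp add: P_def)
    also have "\<dots> \<le> q x + (s + d) * N x" using t(2) N0[of x] by (intro add_left_mono mult_right_mono) auto
    also have "\<dots> \<le> q x + s * N x + d * (N x + 1)" using \<open>d > 0\<close> by (simp add: algebra_simps)
    also note dN
    finally have "0 \<le> (q x + s * N x) + - (q x + s * N x) / 2" .
    moreover have "0 \<le> a + - a / 2 \<Longrightarrow> 0 \<le> a" for a :: real by simp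
    ultimately show False using neg by blast
  qed
  have pM: "psd n (M s)" using sP psdM by blast
  have "s = 0"
  proof (rule ccontr)
    assume "s \<noteq> 0"
    then have s: "s > 0" using s0 by simp
    have "kdet n (M s) \<noteq> 0"
    proof
      assume "kdet n (M s) = 0"
      then obtain v where v: "\<exists>i<n. v i \<noteq> 0" "\<And>i. i < n \<Longrightarrow> mv n (M s) v i = 0"
        by (rule kdet_eq_0_kernel) blast
      have "mv n H v i = - of_real s * v i" if "i < n" for i
        using v(2)[OF that] that by (simp add: M_def[abs_def] mv_kernel_linear mv_idk_left add_eq_0_iff2)
      then show False using spec[OF s, of v] v(1) by blast
    qed
    then obtain R where R: "\<And>i j. i < n \<Longrightarrow> j < n \<Longrightarrow> (\<Sum>l<n. R i l * M s l j) = idk i j"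
      by (rule kdet_inverse) blast
    define \<tau> where "\<tau> = (\<Sum>k<n. Re (M s k k))"
    define B where "B = (\<Sum>i<n. \<Sum>k<n. cmod (R i k))"
    have diag: "0 \<le> Re (M s k k)" "Re (M s k k) \<le> \<tau>" if "k < n" for k
      using psd_diag(2)[OF pM] that by (auto simp: \<tau>_def intro!: member_le_sum)
    have \<tau>: "0 \<le> \<tau>" unfolding \<tau>_def by (intro sum_nonneg) (use diag in auto)
    have B: "0 \<le> B" by (simp add: B_def sum_nonneg)
    define C where "C = real n * (B\<^sup>2 * \<tau>) + 1"
    have C: "C > 0" unfolding C_def using \<tau> by (simp add: add_nonneg_pos)
    \<comment> \<open>Nonnegativity of the Schur complements, a form of Cauchy-Schwarz, bounds the
      entries of (M s) x by the form; applying \<open>R\<close> carries the bound over to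
      \<open>x\<close>.\<close>
    have bound: "N x \<le> C * (q x + s * N x)" for x
    proof -
      define e where "e = q x + s * N x"
      have e0: "0 \<le> e" unfolding e_def by (rule sP)
      have Mx: "(cmod (mv n (M s) x k))\<^sup>2 \<le> \<tau> * e" if k: "k < n" for k
      proof (cases "Re (M s k k) = 0")
        case True
        then have "M s k k = 0" using psd_diag(1)[OF pM k] by simp
        then show ?thesis using psd_zero_diag[OF pM k] \<tau> e0 by simp
      next
        case False
        have "0 \<le> Re (ip n (mv n (schur (M s) k) x) x)" by (rule psd_nonneg[OF schur_psd[OF pM k]])
        then have "(cmod (mv n (M s) x k))\<^sup>2 / Re (M s k k) \<le> e"
          unfolding schur_form[OF pM k] form e_def by simp
        then have "(cmod (mv n (M s) x k))\<^sup>2 \<le> Re (M s k k) * e"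
          using False diag(1)[OF k] by (simp add: field_simps)
        also have "\<dots> \<le> \<tau> * e" using diag(2)[OF k] e0 by (rule mult_right_mono)
        finally show ?thesis .
      qed
      have xi: "(cmod (x i))\<^sup>2 \<le> B\<^sup>2 * \<tau> * e" if i: "i < n" for i
      proof -
        have "x i = mv n idk x i" by (simp add: mv_idk_left[OF i])
        also have "\<dots> = mv n R (mv n (M s) x) i"
          unfolding mv_compose by (rule mv_cong) (simp_all add: R i)
        finally have "cmod (x i) \<le> (\<Sum>k<n. cmod (R i k) * cmod (mv n (M s) x k))"
          using norm_sum[of "\<lambda>k. R i k * mv n (M s) x k" "{..<n}"] by (simp add: mv_def[of n R] norm_mult)
        also have "\<dots> \<le> (\<Sum>k<n. cmod (R i k) * sqrt (\<tau> * e))"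
          by (intro sum_mono mult_left_mono) (use Mx real_le_rsqrt in auto)
        also have "\<dots> = (\<Sum>k<n. cmod (R i k)) * sqrt (\<tau> * e)" by (simp add: sum_distrib_right)
        also have "\<dots> \<le> B * sqrt (\<tau> * e)"
          unfolding B_def using i \<tau> e0
          by (intro mult_right_mono member_le_sum[of i _ "\<lambda>i. \<Sum>k<n. cmod (R i k)"]) (auto intro: sum_nonneg)
        finally have "(cmod (x i))\<^sup>2 \<le> (B * sqrt (\<tau> * e))\<^sup>2" by (rule power_mono) simp
        then show ?thesis using \<tau> e0 by (simp add: power_mult_distrib)
      qed
      have "N x \<le> (\<Sum>i<n. B\<^sup>2 * \<tau> * e)" unfolding N by (rule sum_mono) (use xi in auto)
      also have "\<dots> \<le> C * e" using e0 by (simp add: C_def algebra_simps)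
      finally show ?thesis by (simp add: e_def)
    qed
    \<comment> \<open>By the bound the shift may drop by 1 / C; the minimum with \<open>s\<close>
      keeps it nonnegative.\<close>
    define d where "d = min s (1 / C)"
    have d: "0 < d" "d \<le> s" "d * C \<le> 1" using s C by (auto simp: d_def min_def field_simps)
    have "s - d \<in> P"
      unfolding P_def
    proof (intro CollectI conjI allI)
      show "0 \<le> s - d" using d by simp
      fix x
      have "d * N x \<le> d * (C * (q x + s * N x))" using bound[of x] d(1) by (intro mult_left_mono) auto
      also have "\<dots> \<le> 1 * (q x + s * N x)"
        unfolding mult.assoc[symmetric] by (rule mult_right_mono[OF d(3) sP])
      finally show "0 \<le> q x + (s - d) * N x" by (simp add: algebra_simps)
    qed
    then have "s \<le> s - d" unfolding s_def by (rule cInf_lower[OF _ bdd])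
    then show False using d(1) by simp
  qed
  moreover have "psd n (M 0) = psd n H" by (rule psd_cong) (simp add: M_def)
  ultimately show ?thesis using pM by simp
qed

section \<open>Stability and proper position\<close>

lemma Im_ip_shift:
  "Im (ip n v (\<lambda>i. (z i - 1) * v i)) = - (\<Sum>i<n. (cmod (v i))\<^sup>2 * Im (z i))"
proof -
  have "ip n v (\<lambda>i. (z i - 1) * v i) = (\<Sum>i<n. of_real ((cmod (v i))\<^sup>2) * cnj (z i - 1))"
    unfolding ip_def complex_norm_square by (intro sum.cong refl) simp
  then show ?thesis by (simp add: Im_sum sum_negf[symmetric])
qed

lemma mv_gen:
  "i < n \<Longrightarrow> mv n (\<lambda>i j. idk i j + K i j * d j) v i = v i + mv n K (\<lambda>j. d j * v j) i"
  by (simp add: mv_kernel_linear mv_idk_left) (simp add: mv_def mult_ac)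

lemma kdet_stable:
  assumes K: "psd n K" and z: "\<And>i. i < n \<Longrightarrow> 0 < Im (z i)"
  shows "kdet n (\<lambda>i j. idk i j + K i j * (z j - 1)) \<noteq> 0"
proof
  assume "kdet n (\<lambda>i j. idk i j + K i j * (z j - 1)) = 0"
  then obtain v where v: "\<exists>i<n. v i \<noteq> 0"
    "\<And>i. i < n \<Longrightarrow> mv n (\<lambda>i j. idk i j + K i j * (z j - 1)) v i = 0"
    by (rule kdet_eq_0_kernel) blast
  let ?y = "\<lambda>i. (z i - 1) * v i"
  have "0 = ip n (\<lambda>i. v i + mv n K ?y i) ?y"
    unfolding ip_def using v(2) mv_gen[of _ n K "\<lambda>j. z j - 1" v] by simp
  also have "\<dots> = ip n v ?y + ip n (mv n K ?y) ?y" by (rule ip_add_left)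
  finally have "Im (ip n v ?y + ip n (mv n K ?y) ?y) = 0" by (simp only: zero_complex.simps)
  then have "Im (ip n v ?y) = 0" using psd_form_real[OF K, of ?y] by simp
  then have "(\<Sum>i<n. (cmod (v i))\<^sup>2 * Im (z i)) = 0" by (simp add: Im_ip_shift)
  moreover have "0 \<le> (cmod (v i))\<^sup>2 * Im (z i)" if "i < n" for i using z[OF that] by simp
  ultimately have "\<forall>i\<in>{..<n}. (cmod (v i))\<^sup>2 * Im (z i) = 0"
    by (subst (asm) sum_nonneg_eq_0_iff) auto
  note terms = this
  obtain i where i: "i < n" "v i \<noteq> 0" using v(1) by blast
  then show False using terms z[OF i(1)] by auto
qed

text \<open>The sum factors as det M times 1 + (sum of c_j y_j) + w, where M y = u. If it vanished,
  pairing M y = u with (Z - I) y would equate Im w > 0 with a nonpositive number.\<close>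

lemma kdet_proper_position:
  assumes K: "psd n K" and z: "\<And>i. i < n \<Longrightarrow> 0 < Im (z i)" and w: "0 < Im w"
  shows "kdet n (\<lambda>i j. idk i j + (K i j + u i * cnj (u j)) * (z j - 1))
    + w * kdet n (\<lambda>i j. idk i j + K i j * (z j - 1)) \<noteq> 0"
proof
  define M where "M i j = idk i j + K i j * (z j - 1)" for i j
  define c where "c j = cnj (u j) * (z j - 1)" for j
  assume *: "kdet n (\<lambda>i j. idk i j + (K i j + u i * cnj (u j)) * (z j - 1))
    + w * kdet n (\<lambda>i j. idk i j + K i j * (z j - 1)) = 0"
  have M0: "kdet n M \<noteq> 0" using kdet_stable[OF K z] by (simp add: M_def[abs_def])
  then obtain R where R: "\<And>i j. i < n \<Longrightarrow> j < n \<Longrightarrow> (\<Sum>l<n. M i l * R l j) = idk i j"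
    by (rule kdet_inverse) blast
  define y where "y = mv n R u"
  have My: "mv n M y i = u i" if "i < n" for i
    unfolding y_def mv_compose mv_idk_left[OF that, of u, symmetric] by (rule mv_cong) (simp_all add: R that)
  have "kdet n (\<lambda>i j. idk i j + (K i j + u i * cnj (u j)) * (z j - 1)) =
    kdet n (\<lambda>i j. \<Sum>l<n. M i l * (idk l j + y l * c j))"
  proof (rule kdet_cong)
    fix i j assume ij: "i < n" "j < n"
    have "(\<Sum>l<n. M i l * (idk l j + y l * c j)) = mv n M (\<lambda>l. idk j l) i + mv n M y i * c j"
      by (simp add: mv_def sum.distrib sum_distrib_left sum_distrib_right algebra_simps idk_def eq_commute[of j])
    also have "\<dots> = M i j + u i * c j" using ij by (simp add: mv_idk_right My)
    finally show "idk i j + (K i j + u i * cnj (u j)) * (z j - 1) =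
      (\<Sum>l<n. M i l * (idk l j + y l * c j))" by (simp add: M_def c_def algebra_simps)
  qed
  also have "\<dots> = kdet n M * (1 + (\<Sum>j<n. c j * y j))"
    by (simp only: kdet_mult kdet_rank_one_update)
  finally have "kdet n M * (1 + (\<Sum>j<n. c j * y j) + w) = 0"
    using * by (simp add: M_def[abs_def] algebra_simps)
  then have "1 + (\<Sum>j<n. c j * y j) + w = 0" using M0 by (simp only: mult_eq_0_iff simp_thms)
  moreover have "(\<Sum>j<n. c j * y j) = (1 + (\<Sum>j<n. c j * y j) + w) - 1 - w" by simp
  ultimately have cy: "(\<Sum>j<n. c j * y j) = - 1 - w" by simp
  let ?d = "\<lambda>i. (z i - 1) * y i"
  have "ip n ?d u = - 1 - w" unfolding cy[symmetric] by (simp add: ip_def c_def mult_ac)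
  then have "cnj (- 1 - w) = ip n u ?d" using ip_commute[of n u ?d] by simp
  also have "\<dots> = ip n (\<lambda>i. y i + mv n K ?d i) ?d"
    by (rule ip_cong) (use My mv_gen[of _ n K "\<lambda>j. z j - 1" y] in \<open>simp_all add: M_def[abs_def]\<close>)
  also have "\<dots> = ip n y ?d + ip n (mv n K ?d) ?d" by (rule ip_add_left)
  finally have "Im (cnj (- 1 - w)) = Im (ip n y ?d)" using psd_form_real[OF K, of ?d] by simp
  then have "Im w = - (\<Sum>i<n. (cmod (y i))\<^sup>2 * Im (z i))" by (simp add: Im_ip_shift)
  moreover have "0 \<le> (\<Sum>i<n. (cmod (y i))\<^sup>2 * Im (z i))"
    by (intro sum_nonneg mult_nonneg_nonneg) (use z in \<open>auto intro: less_imp_le\<close>)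
  ultimately show False using w by simp
qed

subsection \<open>Measures with a given kernel\<close>

text \<open>Prescribing point masses instead of inclusion probabilities makes the generating
  polynomial a single determinant.\<close>

definition has_kernel :: "nat \<Rightarrow> nat set pmf \<Rightarrow> (nat \<Rightarrow> nat \<Rightarrow> complex) \<Rightarrow> bool" where
  "has_kernel n \<mu> K \<longleftrightarrow> prob_on n \<mu> \<and> (\<forall>T\<subseteq>{..<n}. of_real (pmf \<mu> T) = wt n K T)"

text \<open>Supplies the intermediate measures of the chain.\<close>

lemma has_kernel_exists:
  assumes "contraction n K"
  shows "\<exists>\<mu>. has_kernel n \<mu> K"
proof -
  define p where "p T = (if T \<subseteq> {..<n} then pr n K T else 0)" for T
  have nn: "0 \<le> p T" for T using wt_real_nonneg(2)[OF assms] by (simp add: p_def)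
  have "(\<integral>\<^sup>+ T. ennreal (p T) \<partial>count_space UNIV) = (\<Sum>T\<in>Pow {..<n}. ennreal (p T))"
    by (rule nn_integral_count_space') (auto simp: p_def)
  also have "\<dots> = ennreal (\<Sum>T\<in>Pow {..<n}. p T)" by (rule sum_ennreal) (rule nn)
  also have "(\<Sum>T\<in>Pow {..<n}. p T) = expect n K (\<lambda>_. 1)" by (simp add: p_def expect_def)
  finally have one: "(\<integral>\<^sup>+ T. ennreal (p T) \<partial>count_space UNIV) = 1" by (simp add: expect_const)
  have "set_pmf (embed_pmf p) \<subseteq> Pow {..<n}"
    unfolding set_embed_pmf[OF nn one] by (auto simp: p_def split: if_splits)
  moreover have "of_real (pmf (embed_pmf p) T) = wt n K T" if "T \<subseteq> {..<n}" for T
    unfolding pmf_embed_pmf[OF nn one] wt_real_nonneg(1)[OF assms, of T] using that by (simp add: p_def)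
  ultimately have "has_kernel n (embed_pmf p) K" by (simp add: has_kernel_def prob_on_def)
  then show ?thesis by blast
qed

lemma prob_on_pmf_0: "prob_on n \<mu> \<Longrightarrow> \<not> T \<subseteq> {..<n} \<Longrightarrow> pmf \<mu> T = 0"
  by (auto simp: prob_on_def pmf_eq_0_set_pmf)

lemma has_kernel_unique:
  assumes "has_kernel n \<mu> K" "has_kernel n \<nu> L" "\<And>i j. i < n \<Longrightarrow> j < n \<Longrightarrow> K i j = L i j"
  shows "\<mu> = \<nu>"
proof (rule pmf_eqI)
  fix T
  show "pmf \<mu> T = pmf \<nu> T"
  proof (cases "T \<subseteq> {..<n}")
    case True
    then have "complex_of_real (pmf \<mu> T) = of_real (pmf \<nu> T)"
      using assms(1,2) wt_cong[of n K L T] assms(3) by (simp add: has_kernel_def)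
    then show ?thesis by simp
  next
    case False
    then have "pmf \<mu> T = 0" "pmf \<nu> T = 0"
      using prob_on_pmf_0[of n _ T] assms(1,2) unfolding has_kernel_def by blast+
    then show ?thesis by simp
  qed
qed

lemma gen_poly_kernel:
  assumes "has_kernel n \<mu> K"
  shows "gen_poly n \<mu> z = kdet n (\<lambda>i j. idk i j + K i j * (z j - 1))"
proof -
  have "gen_poly n \<mu> z = (\<Sum>T\<in>Pow {..<n}. (\<Prod>j\<in>T. z j) * wt n K T)"
    unfolding gen_poly_def by (intro sum.cong refl) (use assms in \<open>simp add: has_kernel_def\<close>)
  then show ?thesis by (simp add: wt_gen_poly)
qed

lemma has_kernel_strongly_Rayleigh:
  assumes "has_kernel n \<mu> K" "psd n K"
  shows "\<mu> \<in> strongly_Rayleigh n"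
  using assms kdet_stable[OF assms(2)]
  by (simp add: strongly_Rayleigh_def stable_def gen_poly_kernel[OF assms(1)])
    (simp add: has_kernel_def)

lemma has_kernel_proper_position:
  assumes "has_kernel n \<mu> K" "has_kernel n \<nu> (\<lambda>i j. K i j + u i * cnj (u j))" "psd n K"
  shows "proper_position n (gen_poly n \<mu>) (gen_poly n \<nu>)"
  using kdet_proper_position[OF assms(3)]
  by (auto simp: proper_position_def stable_def gen_poly_kernel[OF assms(1)] gen_poly_kernel[OF assms(2)])

section \<open>Finite chains in proper position\<close>

lemma sr_le_chain_refl: "\<mu> \<in> strongly_Rayleigh n \<Longrightarrow> sr_le_chain n \<mu> \<mu>"
  unfolding sr_le_chain_def by (rule exI[of _ 0], rule exI[of _ "\<lambda>_. \<mu>"]) simp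

lemma sr_le_chain_Cons:
  assumes "\<mu> \<in> strongly_Rayleigh n" "proper_position n (gen_poly n \<mu>) (gen_poly n \<mu>')" "sr_le_chain n \<mu>' \<nu>"
  shows "sr_le_chain n \<mu> \<nu>"
proof -
  from assms(3) obtain l \<rho> where *: "\<rho> 0 = \<mu>'" "\<rho> l = \<nu>" "\<And>i. i \<le> l \<Longrightarrow> \<rho> i \<in> strongly_Rayleigh n"
    "\<And>i. i < l \<Longrightarrow> proper_position n (gen_poly n (\<rho> i)) (gen_poly n (\<rho> (Suc i)))"
    unfolding sr_le_chain_def by blast
  define \<rho>' where "\<rho>' i = (case i of 0 \<Rightarrow> \<mu> | Suc i \<Rightarrow> \<rho> i)" for i
  show ?thesis unfolding sr_le_chain_def
  proof (intro exI[of _ "Suc l"] exI[of _ \<rho>'] conjI allI impI)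
    show "\<rho>' 0 = \<mu>" "\<rho>' (Suc l) = \<nu>" using *(2) by (simp_all add: \<rho>'_def)
    fix i
    show "\<rho>' i \<in> strongly_Rayleigh n" if "i \<le> Suc l"
      using that assms(1) *(3) by (cases i) (auto simp: \<rho>'_def)
    show "proper_position n (gen_poly n (\<rho>' i)) (gen_poly n (\<rho>' (Suc i)))" if "i < Suc l"
      using that assms(2) *(1,4) by (cases i) (auto simp: \<rho>'_def)
  qed
qed

text \<open>The increment \<open>C\<close> is split off one rank at a time by Gaussian elimination: each step subtracts
  \<open>u u\<^sup>*\<close>, where \<open>u\<close> is a normalised column of \<open>C\<close>, and so leaves a Schur complement.\<close>

lemma sr_le_chain_kernel:
  assumes "psd n C" "psd n K" "contraction n (\<lambda>i j. K i j + C i j)"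
    "has_kernel n \<mu> K" "has_kernel n \<nu> (\<lambda>i j. K i j + C i j)"
  shows "sr_le_chain n \<mu> \<nu>"
  using assms
proof (induction "card {k. k < n \<and> C k k \<noteq> 0}" arbitrary: C K \<mu> rule: less_induct)
  case less
  note C = less.prems(1) and K = less.prems(2) and KC = less.prems(3)
  have SR: "\<mu> \<in> strongly_Rayleigh n" by (rule has_kernel_strongly_Rayleigh[OF less.prems(4) K])
  show ?case
  proof (cases "\<exists>k<n. C k k \<noteq> 0")
    case False
    then have "C i j = 0" if "i < n" "j < n" for i j
      using psd_zero_diag_entries(1)[OF C that(1) _ that(2)] that by blast
    then have "\<mu> = \<nu>" by (intro has_kernel_unique[OF less.prems(4,5)]) simp
    then show ?thesis using sr_le_chain_refl[OF SR] by simp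
  next
    case True
    then obtain k where k: "k < n" "C k k \<noteq> 0" by blast
    define r where "r = Re (C k k)"
    have r: "C k k = of_real r" "0 < r" using psd_diag[OF C k(1)] k(2) by (auto simp: r_def less_le)
    define u where "u i = C i k / of_real (sqrt r)" for i
    have uu: "u i * cnj (u j) = C i k * C k j / C k k" if "i < n" "j < n" for i j
    proof -
      have "cnj (C j k) = C k j" using psd_hermitian[OF C that(2) k(1)] by simp
      moreover have "complex_of_real (sqrt r) * of_real (sqrt r) = of_real r"
        using r(2) by (simp flip: of_real_mult)
      ultimately show ?thesis by (simp add: u_def r(1))
    qed
    define L where "L i j = K i j + u i * cnj (u j)" for i j
    have L: "psd n L" unfolding L_def[abs_def] by (intro psd_add K psd_rank_one)
    have LC: "L i j + schur C k i j = K i j + C i j" if "i < n" "j < n" for i j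
      using uu[OF that] by (simp add: L_def schur_def)
    have sC: "psd n (schur C k)" by (rule schur_psd[OF C k(1)])
    have cLC: "contraction n (\<lambda>i j. L i j + schur C k i j)"
    proof -
      have "psd n (\<lambda>i j. L i j + schur C k i j) = psd n (\<lambda>i j. K i j + C i j)"
        "psd n (\<lambda>i j. idk i j - (L i j + schur C k i j)) = psd n (\<lambda>i j. idk i j - (K i j + C i j))"
        by (rule psd_cong; simp add: LC)+
      then show ?thesis using KC by (simp add: contraction_def)
    qed
    \<comment> \<open>\<open>L\<close> stays below K + C, hence below I, because the remainder
      \<open>schur C k\<close> is positive semidefinite.\<close>
    have cL: "contraction n L"
    proof (rule contractionI[OF L])
      show "kle n L idk"
        unfolding kle_def
      proof -
        have "psd n (\<lambda>i j. (idk i j - (L i j + schur C k i j)) + schur C k i j)"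
          using cLC by (intro psd_add sC) (simp add: contraction_def)
        then show "psd n (\<lambda>i j. idk i j - L i j)" by simp
      qed
    qed
    obtain \<mu>' where \<mu>': "has_kernel n \<mu>' L" using has_kernel_exists[OF cL] by blast
    \<comment> \<open>The induction measure drops: zero diagonal entries of \<open>C\<close> stay
      zero, and the \<open>k\<close>-th becomes zero.\<close>
    have "{j. j < n \<and> schur C k j j \<noteq> 0} \<subset> {j. j < n \<and> C j j \<noteq> 0}"
    proof
      show "{j. j < n \<and> schur C k j j \<noteq> 0} \<subseteq> {j. j < n \<and> C j j \<noteq> 0}"
      proof (intro subsetI, clarify)
        fix j assume j: "j < n" "schur C k j j \<noteq> 0" "C j j = 0"
        then show False using psd_zero_diag_entries(1)[OF C j(1,3) k(1)] by (simp add: schur_def)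
      qed
      show "{j. j < n \<and> schur C k j j \<noteq> 0} \<noteq> {j. j < n \<and> C j j \<noteq> 0}"
      proof
        assume "{j. j < n \<and> schur C k j j \<noteq> 0} = {j. j < n \<and> C j j \<noteq> 0}"
        then have "schur C k k k \<noteq> 0" using k by blast
        then show False by (simp add: schur_def)
      qed
    qed
    then have "card {j. j < n \<and> schur C k j j \<noteq> 0} < card {j. j < n \<and> C j j \<noteq> 0}"
      by (intro psubset_card_mono) auto
    moreover have "has_kernel n \<nu> (\<lambda>i j. L i j + schur C k i j)"
      using less.prems(5) wt_cong[OF LC, of n] by (simp add: has_kernel_def)
    ultimately have "sr_le_chain n \<mu>' \<nu>"
      by (intro less.hyps[OF _ sC L cLC \<mu>'])
    moreover have "proper_position n (gen_poly n \<mu>) (gen_poly n \<mu>')"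
      by (rule has_kernel_proper_position[OF less.prems(4) _ K, of _ u]) (use \<mu>' in \<open>simp add: L_def[abs_def]\<close>)
    ultimately show ?thesis using sr_le_chain_Cons[OF SR] by blast
  qed
qed

text \<open>Inclusion-exclusion as an induction from the largest sets down: the strictly larger sets
  cancel. It recovers point masses from inclusion probabilities.\<close>

lemma upsum_injective:
  fixes f g :: "nat set \<Rightarrow> complex"
  assumes "finite N" "\<And>S. S \<subseteq> N \<Longrightarrow> (\<Sum>T | T \<subseteq> N \<and> S \<subseteq> T. f T) = (\<Sum>T | T \<subseteq> N \<and> S \<subseteq> T. g T)"
    and "S \<subseteq> N"
  shows "f S = g S"
  using assms(3)
proof (induction "card (N - S)" arbitrary: S rule: less_induct)
  case less
  have e: "{T. T \<subseteq> N \<and> S \<subseteq> T} = insert S {T. T \<subseteq> N \<and> S \<subset> T}" using less.prems by auto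
  have fin: "finite {T. T \<subseteq> N \<and> S \<subset> T}" using assms(1) by (rule_tac finite_subset[of _ "Pow N"]) auto
  have "f T = g T" if "T \<subseteq> N" "S \<subset> T" for T
    using that assms(1) by (intro less.hyps psubset_card_mono) auto
  then have "(\<Sum>T | T \<subseteq> N \<and> S \<subset> T. f T) = (\<Sum>T | T \<subseteq> N \<and> S \<subset> T. g T)"
    by (intro sum.cong) auto
  then show ?case using assms(2)[OF less.prems] fin unfolding e by simp
qed

lemma determinantal_has_kernel:
  assumes "A \<in> carrier_mat n n" "determinantal n A \<mu>"
  shows "has_kernel n \<mu> (\<lambda>i j. A $$ (i, j))"
proof -
  let ?K = "\<lambda>i j. A $$ (i, j)"
  have "complex_of_real (pmf \<mu> S) = wt n ?K S" if "S \<subseteq> {..<n}" for S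
    using that
  proof (rule upsum_injective[rotated 2])
    fix S assume S: "S \<subseteq> {..<n}"
    have fin: "finite {T. T \<subseteq> {..<n} \<and> S \<subseteq> T}" by (rule finite_subset[of _ "Pow {..<n}"]) auto
    have "(\<Sum>T | T \<subseteq> {..<n} \<and> S \<subseteq> T. complex_of_real (pmf \<mu> T)) =
      of_real (measure_pmf.prob \<mu> {T. T \<subseteq> {..<n} \<and> S \<subseteq> T})"
      by (simp add: measure_measure_pmf_finite[OF fin])
    also have "\<dots> = Determinant.det (submatrix A S S)" using assms(2) S by (simp add: determinantal_def)
    also have "\<dots> = (\<Sum>T | T \<subseteq> {..<n} \<and> S \<subseteq> T. wt n ?K T)"
      by (simp add: det_submatrix_kdet[OF assms(1) S] wt_upsum[OF S])
    finally show "(\<Sum>T | T \<subseteq> {..<n} \<and> S \<subseteq> T. complex_of_real (pmf \<mu> T)) =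
      (\<Sum>T | T \<subseteq> {..<n} \<and> S \<subseteq> T. wt n ?K T)" .
  qed simp
  then show ?thesis using assms(2) by (simp add: has_kernel_def determinantal_def)
qed

section \<open>From matrices to kernels\<close>

lemma pos_semidef_psd:
  assumes "pos_semidef n A"
  shows "psd n (\<lambda>i j. A $$ (i, j))"
proof (rule psdI_form)
  fix x :: "nat \<Rightarrow> complex"
  have A: "A \<in> carrier_mat n n" using assms by (simp add: pos_semidef_def)
  have "(A *\<^sub>v vec n x) \<bullet>c vec n x = (\<Sum>i<n. vec_index (A *\<^sub>v vec n x) i * cnj (x i))"
    by (simp add: scalar_prod_def atLeast0LessThan)
  also have "\<dots> = ip n (mv n (\<lambda>i j. A $$ (i, j)) x) x"
    unfolding ip_def by (intro sum.cong refl) (use A in \<open>simp add: mv_def scalar_prod_def atLeast0LessThan\<close>)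
  finally have "(A *\<^sub>v vec n x) \<bullet>c vec n x = ip n (mv n (\<lambda>i j. A $$ (i, j)) x) x" .
  then show "0 \<le> ip n (mv n (\<lambda>i j. A $$ (i, j)) x) x"
    using assms by (metis pos_semidef_def vec_carrier)
qed

text \<open>The eigenvalue bound becomes the form bound K <= I: an eigenvalue -t < 0 of I - A would
  be an eigenvalue 1 + t > 1 of \<open>A\<close>.\<close>

lemma positive_contraction_kernel:
  assumes "positive_contraction n A"
  shows "contraction n (\<lambda>i j. A $$ (i, j))"
proof -
  let ?K = "\<lambda>i j. A $$ (i, j)"
  have A: "A \<in> carrier_mat n n" "psd n ?K"
    using assms by (simp_all add: positive_contraction_def pos_semidef_psd) (simp add: pos_semidef_def)
  have "psd n (\<lambda>i j. idk i j - ?K i j)"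
  proof (rule psd_from_spectrum)
    fix i j assume "i < n" "j < n"
    then show "idk j i - ?K j i = cnj (idk i j - ?K i j)"
      using psd_hermitian[OF A(2), of i j] by (simp add: idk_def)
  next
    fix t :: real and v :: "nat \<Rightarrow> complex" and i
    assume t: "0 < t" and i: "i < n"
      and v: "\<And>i. i < n \<Longrightarrow> mv n (\<lambda>i j. idk i j - ?K i j) v i = - of_real t * v i"
    show "v i = 0"
    proof (rule ccontr)
      assume nz: "v i \<noteq> 0"
      have "eigenvector A (vec n v) (of_real (1 + t))"
        unfolding eigenvector_def
      proof (intro conjI)
        show "vec n v \<in> carrier_vec (dim_row A)" using A(1) by simp
        show "vec n v \<noteq> 0\<^sub>v (dim_row A)" using A(1) nz i by (metis carrier_matD(1) index_vec index_zero_vec(1))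
        show "A *\<^sub>v vec n v = of_real (1 + t) \<cdot>\<^sub>v vec n v"
        proof (rule eq_vecI)
          fix j assume "j < dim_vec (of_real (1 + t) \<cdot>\<^sub>v vec n v)"
          then have j: "j < n" by simp
          have "vec_index (A *\<^sub>v vec n v) j = mv n ?K v j"
            using A(1) j by (simp add: mv_def scalar_prod_def atLeast0LessThan)
          also have "\<dots> = of_real (1 + t) * v j"
            using v[OF j] j by (simp add: mv_kernel_linear mv_idk_left algebra_simps)
          finally show "vec_index (A *\<^sub>v vec n v) j = vec_index (of_real (1 + t) \<cdot>\<^sub>v vec n v) j"
            using j by simp
        qed (use A(1) in simp)
      qed
      then have "complex_of_real (1 + t) \<in> complex_of_real ` {0..1}"
        using assms unfolding positive_contraction_def eigenvalue_def by blast
      then obtain s where "complex_of_real (1 + t) = of_real s" "s \<le> 1" by auto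
      then have "1 + t \<le> 1" using of_real_eq_iff by metis
      then show False using t by simp
    qed
  qed
  then show ?thesis using A(2) by (simp add: contraction_def)
qed

lemma has_kernel_stoch_dominated:
  assumes "has_kernel n \<mu> K" "has_kernel n \<nu> L" "contraction n K" "contraction n L" "kle n K L"
  shows "stoch_dominated n \<mu> \<nu>"
  unfolding stoch_dominated_def
proof (intro allI impI)
  fix E assume E: "increasing_event n E"
  then have sub: "E \<subseteq> Pow {..<n}" by (simp add: increasing_event_def)
  then have fin: "finite E" by (rule finite_subset) simp
  have prob: "measure_pmf.prob \<rho> E = expect n M (indicator E)" if \<rho>: "has_kernel n \<rho> M" for \<rho> M
  proof -
    have "pmf \<rho> T = pr n M T" if "T \<subseteq> {..<n}" for T
      using \<rho> that unfolding has_kernel_def pr_def by (metis Re_complex_of_real)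
    then have "measure_pmf.prob \<rho> E = (\<Sum>T\<in>E. pr n M T)"
      using sub by (simp add: measure_measure_pmf_finite[OF fin] subset_iff)
    also have "\<dots> = expect n M (indicator E)"
      unfolding expect_def by (rule sum.mono_neutral_cong_left) (use sub in auto)
    finally show ?thesis .
  qed
  have "expect n K (indicator E) \<le> expect n L (indicator E)"
  proof (rule expect_mono[OF assms(3-5)])
    fix S T :: "nat set" assume "S \<subseteq> T" "T \<subseteq> {..<n}"
    then show "indicator E S \<le> (indicator E T :: real)"
      using E by (auto simp: increasing_event_def indicator_def)
  qed
  then show "measure_pmf.prob \<mu> E \<le> measure_pmf.prob \<nu> E"
    using prob[OF assms(1)] prob[OF assms(2)] by simp
qed

theorem theorem4p13:
  fixes n :: nat and A B :: "complex mat" and \<mu> \<nu> :: "nat set pmf"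
  assumes "positive_contraction n A" and "positive_contraction n B"
    and "loewner_le n A B"
    and "determinantal n A \<mu>" and "determinantal n B \<nu>"
  shows "sr_le n \<mu> \<nu> \<and> stoch_dominated n \<mu> \<nu>"
proof
  let ?K = "\<lambda>i j. A $$ (i, j)" and ?L = "\<lambda>i j. B $$ (i, j)"
  have carrier: "A \<in> carrier_mat n n" "B \<in> carrier_mat n n"
    using assms(1,2) by (simp_all add: positive_contraction_def pos_semidef_def)
  have K: "contraction n ?K" and L: "contraction n ?L"
    using assms(1,2) by (simp_all add: positive_contraction_kernel)
  have \<mu>: "has_kernel n \<mu> ?K" and \<nu>: "has_kernel n \<nu> ?L"
    using assms(4,5) carrier by (simp_all add: determinantal_has_kernel)
  have "psd n (\<lambda>i j. (B - A) $$ (i, j)) = psd n (\<lambda>i j. ?L i j - ?K i j)"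
    by (rule psd_cong) (use carrier in simp)
  then have C: "psd n (\<lambda>i j. ?L i j - ?K i j)"
    using assms(3) pos_semidef_psd by (simp add: loewner_le_def)
  have pK: "psd n ?K" and pL: "psd n ?L" using K L by (simp_all add: contraction_def)
  have SR: "\<mu> \<in> strongly_Rayleigh n" "\<nu> \<in> strongly_Rayleigh n"
    using \<mu> \<nu> pK pL has_kernel_strongly_Rayleigh by blast+
  have "sr_le_chain n \<mu> \<nu>"
    by (rule sr_le_chain_kernel[OF C pK]) (use L \<mu> \<nu> in simp_all)
  \<comment> \<open>The chain joins \<open>\<mu>\<close> and \<open>\<nu>\<close> themselves, so
    constant sequences serve as approximations.\<close>
  then show "sr_le n \<mu> \<nu>"
    unfolding sr_le_def prob_tendsto_def
    by (intro conjI SR exI[of _ "\<lambda>_. \<mu>"] exI[of _ "\<lambda>_. \<nu>"]) (use SR in simp_all)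
  show "stoch_dominated n \<mu> \<nu>"
    by (rule has_kernel_stoch_dominated[OF \<mu> \<nu> K L]) (use C in \<open>simp add: kle_def\<close>)
qed

end
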